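(* Let $N$ be a positive integer. Then $$\|f\|_{\mathcal{B}}\;\approx\;\|\boldsymbol{\rho}^N\mathcal{L}_n^Nf\|_\infty\;\approx\;\sum_{\alpha\in\mathbb{N}_0^n,\ |\alpha|=N}\|\boldsymbol{\rho}^{\langle\alpha\rangle}\mathcal{L}^\alpha f\|_\infty$$ as $f$ ranges over $\widetilde{\mathcal{B}}$; that is, any two of these three quantities are comparable up to positive multiplicative constants independent of $f\in\widetilde{\mathcal{B}}$.
   Context: Let $n$ be a positive integer; write $z=(z',z_n)\in\mathbb{C}^n$ with $z'=(z_1,\dots,z_{n-1})$. Put $\boldsymbol{\rho}(z)=\operatorname{Im}z_n-|z'|^2$, $\mathcal{U}=\{z\in\mathbb{C}^n:\boldsymbol{\rho}(z)>0\}$ and $\mathbf{i}=(0',i)$. Let $\mathcal{L}_j=\partial_j+2i\overline{z}_j\partial_n$ for $1\le j\le n-1$ and $\mathcal{L}_n=\partial_n$, where $\partial_j=\partial/\partial z_j$. For a multi-index $\alpha\in\mathbb{N}_0^n$ ($\mathbb{N}_0$ the nonnegative integers), $\mathcal{L}^\alpha=(\mathcal{L}_1)^{\alpha_1}\cdots(\mathcal{L}_n)^{\alpha_n}$, $|\alpha|=\alpha_1+\cdots+\alpha_n$, $|\alpha'|=\alpha_1+\cdots+\alpha_{n-1}$ and $\langle\alpha\rangle=|\alpha'|/2+\alpha_n$. $\|\cdot\|_\infty$ is the supremum norm over $\mathcal{U}$. For $f$ holomorphic on $\mathcal{U}$ let $|\widetilde{\nabla}f|=\big(2\boldsymbol{\rho}\sum_{j=1}^{n-1}|\mathcal{L}_jf|^2+8\boldsymbol{\rho}^2|\mathcal{L}_nf|^2\big)^{1/2}$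 and $\|f\|_{\mathcal{B}}=\sup_{z\in\mathcal{U}}|\widetilde{\nabla}f(z)|$. $\widetilde{\mathcal{B}}$ is the space of holomorphic $f$ on $\mathcal{U}$ with $\|f\|_{\mathcal{B}}<\infty$ and $f(\mathbf{i})=0$. *)

theory Defs
  imports "HOL-Analysis.Analysis"
begin

text \<open>
  The space C^n is rendered as \<open>complex ^ 'n\<close> for a finite, linearly ordered index type \<open>'n\<close>
  with n elements (n \<ge> 1 arbitrary). The last coordinate z_n is the one at the largest index;
  z' consists of the remaining coordinates (none if n = 1).
\<close>

type_synonym 'n cvec = "(complex, 'n) vec"

definition last_ix :: "'n::{finite,linorder}" where
  "last_ix = Max UNIV"

definition rho :: "('n::{finite,linorder}) cvec \<Rightarrow> real" where
  "rho z = Im (z $ last_ix) - (\<Sum>j\<in>UNIV - {last_ix}. (cmod (z $ j))\<^sup>2)"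

definition siegel :: "('n::{finite,linorder}) cvec set" where
  "siegel = {z. rho z > 0}"

definition base_pt :: "('n::{finite,linorder}) cvec" where
  "base_pt = axis last_ix \<i>"

text \<open>Holomorphy of several variables (on open sets): Frechet differentiability with a
  complex-linear derivative.\<close>

definition holo_on :: "(('n::finite) cvec \<Rightarrow> complex) \<Rightarrow> ('n cvec) set \<Rightarrow> bool" where
  "holo_on f S \<longleftrightarrow>
     (\<forall>z\<in>S. \<exists>D. (f has_derivative D) (at z) \<and> (\<forall>c v. D (c *s v) = c * D v))"

text \<open>The Wirtinger derivative, i.e. half of d/dx_j - i d/dy_j. It has to be this operator and not
  a complex derivative, because the operators \<open>LL j\<close> below do not preserve holomorphy.\<close>

definition wirtinger ::
    "'n \<Rightarrow> (('n::finite) cvec \<Rightarrow> complex) \<Rightarrow> 'n cvec \<Rightarrow> complex" where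
  "wirtinger j f z =
     (vector_derivative (\<lambda>t::real. f (z + axis j (of_real t))) (at 0)
      - \<i> * vector_derivative (\<lambda>t::real. f (z + axis j (\<i> * of_real t))) (at 0)) / 2"

definition LL ::
    "'n \<Rightarrow> (('n::{finite,linorder}) cvec \<Rightarrow> complex) \<Rightarrow> 'n cvec \<Rightarrow> complex" where
  "LL j f z =
     (if j = last_ix then wirtinger last_ix f z
      else wirtinger j f z + 2 * \<i> * cnj (z $ j) * wirtinger last_ix f z)"

text \<open>The composition of the powers of \<open>LL j\<close> in increasing order of j, the smallest index
  being outermost.\<close>

definition LL_multi ::
    "('n \<Rightarrow> nat) \<Rightarrow> (('n::{finite,linorder}) cvec \<Rightarrow> complex) \<Rightarrow> 'n cvec \<Rightarrow> complex" where
  "LL_multi \<alpha> f = foldr (\<lambda>j g. (LL j ^^ \<alpha> j) g) (sorted_list_of_set UNIV) f"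

definition mi_abs :: "('n::finite \<Rightarrow> nat) \<Rightarrow> nat" where
  "mi_abs \<alpha> = (\<Sum>j\<in>UNIV. \<alpha> j)"

text \<open>The index set of the sum in \<open>norm_all\<close> is finite, so that sum is a genuine one.\<close>

lemma finite_mi_abs: "finite {\<alpha> :: 'n::finite \<Rightarrow> nat. mi_abs \<alpha> = N}"
proof (rule finite_subset)
  show "{\<alpha> :: 'n \<Rightarrow> nat. mi_abs \<alpha> = N} \<subseteq> (UNIV::'n set) \<rightarrow>\<^sub>E {..N}"
    by (auto simp: mi_abs_def PiE_def intro: member_le_sum)
  show "finite ((UNIV::'n set) \<rightarrow>\<^sub>E {..N})"
    by (intro finite_PiE) auto
qed

definition mi_weight :: "('n::{finite,linorder} \<Rightarrow> nat) \<Rightarrow> real" where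
  "mi_weight \<alpha> = real (\<Sum>j\<in>UNIV - {last_ix}. \<alpha> j) / 2 + real (\<alpha> last_ix)"

text \<open>Suprema are taken in the extended nonnegative reals, so that they are meaningful (possibly
  infinite) for every function.\<close>

definition sup_norm :: "(('n::{finite,linorder}) cvec \<Rightarrow> complex) \<Rightarrow> ennreal" where
  "sup_norm g = (SUP z\<in>siegel. ennreal (cmod (g z)))"

definition inv_grad :: "(('n::{finite,linorder}) cvec \<Rightarrow> complex) \<Rightarrow> 'n cvec \<Rightarrow> real" where
  "inv_grad f z =
     sqrt (2 * rho z * (\<Sum>j\<in>UNIV - {last_ix}. (cmod (LL j f z))\<^sup>2)
           + 8 * (rho z)\<^sup>2 * (cmod (LL last_ix f z))\<^sup>2)"

definition bloch_norm :: "(('n::{finite,linorder}) cvec \<Rightarrow> complex) \<Rightarrow> ennreal" where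
  "bloch_norm f = (SUP z\<in>siegel. ennreal (inv_grad f z))"

definition bloch_space :: "(('n::{finite,linorder}) cvec \<Rightarrow> complex) set" where
  "bloch_space = {f. holo_on f siegel \<and> bloch_norm f < \<infinity> \<and> f base_pt = 0}"

definition norm_last :: "nat \<Rightarrow> (('n::{finite,linorder}) cvec \<Rightarrow> complex) \<Rightarrow> ennreal" where
  "norm_last N f = sup_norm (\<lambda>z. of_real (rho z ^ N) * (LL last_ix ^^ N) f z)"

definition norm_all :: "nat \<Rightarrow> (('n::{finite,linorder}) cvec \<Rightarrow> complex) \<Rightarrow> ennreal" where
  "norm_all N f =
     (\<Sum>\<alpha> | mi_abs \<alpha> = N.
        sup_norm (\<lambda>z. of_real (rho z powr mi_weight \<alpha>) * LL_multi \<alpha> f z))"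

definition comparable_on :: "'a set \<Rightarrow> ('a \<Rightarrow> ennreal) \<Rightarrow> ('a \<Rightarrow> ennreal) \<Rightarrow> bool" where
  "comparable_on S A B \<longleftrightarrow>
     (\<exists>c C::real. c > 0 \<and> C > 0 \<and>
        (\<forall>f\<in>S. ennreal c * A f \<le> B f \<and> B f \<le> ennreal C * A f))"

end

theory Submission
  imports Defs "HOL-Complex_Analysis.Complex_Analysis"
begin

text \<open>
  Freezing the antiholomorphic coefficients of the operators \<open>LL j\<close> at a point \<open>w\<close> turns them into
  complex directional derivatives along \<open>hvec j w\<close>, and \<open>cnj (z $ k)\<close> is killed by every Wirtinger
  derivative, so iterated \<open>LL j\<close> at \<open>w\<close> are iterated directional derivatives of a holomorphic
  function along frozen directions. For small \<open>r\<close> the polydisc with centre \<open>w\<close> and radii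
  \<open>r * sqrt (rho w)\<close>, \<open>r * rho w\<close> in these directions stays in \<open>siegel\<close>, with \<open>rho\<close> comparable to \<open>rho w\<close>,
  so Cauchy's estimates bound all weighted derivatives by the Bloch norm. Conversely, these bounds
  make the derivatives decay along vertical rays; integrating down from infinity recovers the
  bound for \<open>LL last_ix f\<close> from that of its higher powers, and the bound for \<open>LL j f\<close> from that of
  \<open>LL j (LL last_ix f) = LL last_ix (LL j f)\<close>.
\<close>

section \<open>Holomorphic functions of several variables\<close>

lemma norm_cvec_smult: "norm (c *s (v :: ('n::finite) cvec)) = cmod c * norm v"
  by (simp add: norm_vec_def norm_mult L2_set_right_distrib)

lemma bounded_linear_smult_left: "bounded_linear (\<lambda>c. c *s (v :: ('n::finite) cvec))"
proof (rule bounded_linear_intro)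
  show "(b + c) *s v = b *s v + c *s v" for b c :: complex
    by (simp add: vec_eq_iff algebra_simps)
  show "(r *\<^sub>R b) *s v = r *\<^sub>R (b *s v)" for r b
    by (simp add: vec_eq_iff)
  show "norm (b *s v) \<le> norm b * norm v" for b :: complex
    by (simp add: norm_cvec_smult)
qed

lemma continuous_on_line: "continuous_on T (\<lambda>c. z + c *s (v :: ('n::finite) cvec))"
  by (intro continuous_intros bounded_linear.continuous_on[OF bounded_linear_smult_left])

lemma scaleR_cvec: "r *\<^sub>R (v :: ('n::finite) cvec) = complex_of_real r *s v"
  by (simp add: vec_eq_iff scaleR_conv_of_real[where 'a = complex])

text \<open>The complex derivative of \<open>f\<close> along the line through \<open>z\<close> in
  direction \<open>v\<close>. Being built on the one-variable \<open>deriv\<close>, it is total, can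
  be iterated as an operator on functions, and is open to one-variable Cauchy theory.\<close>

definition pd :: "('n::finite) cvec \<Rightarrow> ('n cvec \<Rightarrow> complex) \<Rightarrow> 'n cvec \<Rightarrow> complex" where
  "pd v f z = deriv (\<lambda>c. f (z + c *s v)) 0"

lemma DERIV_line:
  fixes v z :: "('n::finite) cvec"
  assumes "(f has_derivative D) (at (z + c *s v))" and "\<And>a v. D (a *s v) = a * D v"
  shows "((\<lambda>c. f (z + c *s v)) has_field_derivative D v) (at c)"
proof -
  have "((\<lambda>c. c *s v) has_derivative (\<lambda>h. h *s v)) (at c)"
    by (rule bounded_linear_imp_has_derivative[OF bounded_linear_smult_left])
  then have "((\<lambda>c. z + c *s v) has_derivative (\<lambda>h. h *s v)) (at c)"
    by (auto intro!: derivative_eq_intros)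
  from has_derivative_compose[OF this assms(1)] show ?thesis
    unfolding has_field_derivative_def assms(2) by (rule has_derivative_eq_rhs) (auto simp: mult.commute)
qed

lemma pd_eqI:
  assumes "(f has_derivative D) (at z)" and "\<And>a v. D (a *s v) = a * D v"
  shows "pd v f z = D v"
  using DERIV_line[of f D z 0 v] assms unfolding pd_def by (auto intro: DERIV_imp_deriv)

lemma holo_onD:
  assumes "holo_on f S" "z \<in> S"
  shows holo_on_has_derivative: "(f has_derivative (\<lambda>v. pd v f z)) (at z)"
    and pd_smult: "pd (c *s v) f z = c * pd v f z"
proof -
  obtain D where D: "(f has_derivative D) (at z)" "\<And>c v. D (c *s v) = c * D v"
    using assms unfolding holo_on_def by blast
  have "D = (\<lambda>v. pd v f z)"
    using pd_eqI[OF D] by auto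
  with D show "(f has_derivative (\<lambda>v. pd v f z)) (at z)" "pd (c *s v) f z = c * pd v f z"
    by auto
qed

lemma pd_vec_add:
  assumes "holo_on f S" "z \<in> S"
  shows "pd (u + v) f z = pd u f z + pd v f z"
  using holo_on_has_derivative[OF assms]
  by (rule linear_add[OF has_derivative_linear])

lemma holo_on_DERIV_line:
  assumes "holo_on f S" "z + c *s v \<in> S"
  shows "((\<lambda>c. f (z + c *s v)) has_field_derivative pd v f (z + c *s v)) (at c)"
  by (rule DERIV_line[OF holo_on_has_derivative[OF assms] pd_smult[OF assms]])

lemma holo_on_line:
  assumes "holo_on f S" "T \<subseteq> {c. z + c *s v \<in> S}"
  shows "(\<lambda>c. f (z + c *s v)) holomorphic_on T"
  unfolding holomorphic_on_def field_differentiable_def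
  using holo_on_DERIV_line[OF assms(1)] assms(2)
  by (blast intro: has_field_derivative_at_within)

lemma holo_on_continuous: "holo_on f S \<Longrightarrow> continuous_on S f"
  by (meson continuous_at_imp_continuous_on has_derivative_continuous holo_on_has_derivative)

section \<open>One-variable Cauchy estimates and the linear remainder\<close>

lemma norm_deriv_le:
  assumes "f holomorphic_on cball z r" "0 < r" "\<And>x. x \<in> cball z r \<Longrightarrow> norm (f x) \<le> B"
  shows "norm (deriv f z) \<le> B / r"
  using Cauchy_inequality[OF holomorphic_on_subset[OF assms(1) ball_subset_cball]
      holomorphic_on_imp_continuous_on[OF assms(1)] assms(2), of B 1] assms(3)
  by (simp add: dist_norm)

lemma norm_pd_le:
  assumes "holo_on f S" "0 < r" "\<And>c. cmod c \<le> r \<Longrightarrow> z + c *s v \<in> S \<and> cmod (f (z + c *s v)) \<le> B"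
  shows "cmod (pd v f z) \<le> B / r"
  unfolding pd_def using assms(3)
  by (intro norm_deriv_le[OF holo_on_line[OF assms(1)] assms(2)]) (auto simp: dist_norm)

text \<open>First-order Taylor formula at 0, with the second derivative on the unit disc bounded by
  Cauchy's inequality. The decay in \<open>T\<close> is the point: with
  \<open>T = R / norm h\<close> it becomes a bound quadratic in \<open>h\<close>.\<close>

lemma linear_remainder_disc:
  assumes hol: "f holomorphic_on ball 0 T" and T: "2 \<le> T"
    and bnd: "\<And>x. x \<in> ball 0 T \<Longrightarrow> cmod (f x) \<le> M"
  shows "cmod (f 1 - f 0 - deriv f 0) \<le> 18 * M / T\<^sup>2"
proof -
  have 1: "((deriv ^^ i) f has_field_derivative (deriv ^^ Suc i) f x) (at x within cball 0 1)"
    if "x \<in> cball 0 1" for i x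
  proof -
    have "(deriv ^^ i) f holomorphic_on ball 0 T"
      using hol by (intro holomorphic_higher_deriv) auto
    then show ?thesis
      using that T holomorphic_derivI[of "(deriv ^^ i) f" "ball 0 T" x]
      by (auto intro: has_field_derivative_at_within)
  qed
  have 2: "cmod ((deriv ^^ Suc 1) f x) \<le> 18 * M / T\<^sup>2" if x: "x \<in> cball 0 1" for x
  proof -
    \<comment> \<open>Since \<open>2 \<le> T\<close>, we have \<open>1 + T/3 < T\<close>. The radius
      \<open>T/3\<close> turns the factor \<open>fact 2\<close> of Cauchy's inequality into
      18.\<close>
    have sub: "cball x (T/3) \<subseteq> ball 0 T"
    proof
      fix y assume "y \<in> cball x (T/3)"
      then show "y \<in> ball 0 T"
        using norm_triangle_ineq2[of y x] x T by (auto simp: dist_norm norm_minus_commute)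
    qed
    have "cmod ((deriv ^^ 2) f x) \<le> fact 2 * M / (T/3)^2"
    proof (rule Cauchy_inequality)
      show "f holomorphic_on ball x (T/3)"
        using sub by (intro holomorphic_on_subset[OF hol]) auto
      show "continuous_on (cball x (T/3)) f"
        using sub by (intro holomorphic_on_imp_continuous_on holomorphic_on_subset[OF hol]) auto
      show "cmod (f y) \<le> M" if "cmod (x - y) = T/3" for y
        using that sub by (intro bnd) (auto simp: dist_norm subset_iff)
    qed (use T in auto)
    also have "fact 2 * M / (T/3)^2 = 18 * M / T\<^sup>2"
      by (simp add: field_simps power2_eq_square)
    finally show ?thesis by (simp add: numeral_2_eq_2)
  qed
  have "cmod ((deriv ^^ 0) f 1 - (\<Sum>i\<le>1. (deriv ^^ i) f 0 * (1 - 0) ^ i / fact i))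
      \<le> (18 * M / T\<^sup>2) * cmod (1 - 0) ^ (Suc 1) / fact 1"
    by (rule complex_Taylor[of "cball 0 1"]) (use 1 2 in auto)
  then show ?thesis by (simp add: algebra_simps)
qed

text \<open>Cauchy's estimate makes the linear remainder quadratic, uniformly near a point. This
  substitutes for the continuity of the derivative, which is not part of \<^const>\<open>holo_on\<close>.\<close>

lemma linear_remainder:
  assumes f: "holo_on f S" and S: "open S" "z0 \<in> S"
  obtains R K where "R > 0" "K \<ge> 0" "cball z0 (2*R) \<subseteq> S"
    "\<And>z h. z \<in> cball z0 R \<Longrightarrow> norm h \<le> R/2 \<Longrightarrow> cmod (f (z + h) - f z - pd h f z) \<le> K * (norm h)\<^sup>2"
proof -
  obtain e where e: "e > 0" "cball z0 e \<subseteq> S"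
    using S open_contains_cball by blast
  define R where "R = e/2"
  have R: "R > 0" "cball z0 (2*R) \<subseteq> S" using e by (auto simp: R_def)
  have "compact (f ` cball z0 (2*R))"
    using R f by (intro compact_continuous_image continuous_on_subset[OF holo_on_continuous]) auto
  then obtain M where M: "\<And>x. x \<in> cball z0 (2*R) \<Longrightarrow> cmod (f x) \<le> M"
    using compact_imp_bounded bounded_iff by (metis imageI)
  have M0: "0 \<le> M" using M[of z0] R by (auto intro: order_trans[OF norm_ge_zero])
  have "cmod (f (z + h) - f z - pd h f z) \<le> (18 * M / R\<^sup>2) * (norm h)\<^sup>2"
    if z: "z \<in> cball z0 R" and h: "norm h \<le> R/2" for z h
  proof (cases "h = 0")
    case True
    then show ?thesis by (simp add: pd_def)
  next
    case False
    \<comment> \<open>On the line \<open>c \<mapsto> z + c *s h\<close> the disc of radius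
      \<open>T = R / norm h\<close> is a move by at most \<open>R\<close>, hence stays in
      \<open>cball z0 (2*R)\<close>; the hypothesis \<open>norm h \<le> R/2\<close> is exactly
      \<open>2 \<le> T\<close>.\<close>
    have sub: "z + c *s h \<in> cball z0 (2*R)" if "c \<in> ball 0 (R / norm h)" for c
    proof -
      have "norm (c *s h) \<le> R"
        using that False by (simp add: norm_cvec_smult field_simps)
      then show ?thesis
        using z norm_triangle_ineq[of "z - z0" "c *s h"]
        by (simp add: dist_norm norm_minus_commute algebra_simps)
    qed
    have "cmod (f (z + 1 *s h) - f (z + 0 *s h) - deriv (\<lambda>c. f (z + c *s h)) 0) \<le> 18 * M / (R / norm h)\<^sup>2"
      by (rule linear_remainder_disc[of "\<lambda>c. f (z + c *s h)"])
        (use sub R h False M in \<open>auto intro!: holo_on_line[OF f] simp: field_simps\<close>)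
    then show ?thesis by (simp add: pd_def power_divide)
  qed
  then show thesis using R M0 by (intro that[of R "18 * M / R\<^sup>2"]) auto
qed

section \<open>Directional derivatives of holomorphic functions are holomorphic\<close>

lemma half_step_le:
  fixes a R :: real
  assumes "0 \<le> a" "0 \<le> R"
  shows "R / (2 * (a + 1)) * a \<le> R / 2"
proof -
  have *: "x > 0 \<Longrightarrow> R / (2 * x) * x = R / 2" for x by simp
  have "R / (2 * (a + 1)) * a \<le> R / (2 * (a + 1)) * (a + 1)"
    using assms by (intro mult_left_mono) auto
  also have "\<dots> = R / 2"
    using assms by (intro *) auto
  finally show ?thesis .
qed

text \<open>Along \<open>z0 + c *s v\<close> the linear remainder of \<open>f\<close> for the
  increment \<open>h\<close> is holomorphic in \<open>c\<close> and uniformly of order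
  \<open>(norm h)\<^sup>2\<close>. By Cauchy its derivative at \<open>c = 0\<close> has the same
  order, and this derivative is the linear remainder of \<open>pd v f\<close> at
  \<open>z0\<close>.\<close>

lemma has_derivative_pd:
  fixes f :: "('n::finite) cvec \<Rightarrow> complex"
  assumes f: "holo_on f S" and S: "open S" "z0 \<in> S"
  shows "(pd v f has_derivative (\<lambda>h. pd v (pd h f) z0)) (at z0)"
    and "pd v (pd (a *s h) f) z0 = a * pd v (pd h f) z0"
proof -
  obtain R K where R: "R > 0" and K: "K \<ge> 0" and RS: "cball z0 (2*R) \<subseteq> S"
    and rem: "\<And>z h. z \<in> cball z0 R \<Longrightarrow> norm h \<le> R/2 \<Longrightarrow>
      cmod (f (z + h) - f z - pd h f z) \<le> K * (norm h)\<^sup>2"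
    using linear_remainder[OF f S] by metis
  \<comment> \<open>The summand 1 covers \<open>v = 0\<close>; for \<open>cmod c \<le> r\<close> the
    move \<open>c *s v\<close> has length at most \<open>R/2\<close>, leaving another
    \<open>R/2\<close> for \<open>h\<close>.\<close>
  define r where "r = R / (2 * (norm v + 1))"
  have r: "r > 0" using R by (simp add: r_def add_nonneg_pos)
  have cv: "norm (c *s v) \<le> R/2" if "cmod c \<le> r" for c
  proof -
    have "cmod c * norm v \<le> r * norm v"
      using that by (intro mult_right_mono) auto
    also have "\<dots> \<le> R/2"
      unfolding r_def using R by (intro half_step_le) auto
    finally show ?thesis by (simp add: norm_cvec_smult)
  qed
  have inR: "z0 + c *s v \<in> cball z0 R" if "c \<in> ball 0 r" for c
    using cv[of c] that R by (simp add: dist_norm)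
  have inS: "z0 + h + c *s v \<in> S" if "c \<in> ball 0 r" "norm h \<le> R/2" for c h
  proof -
    have "norm (h + c *s v) \<le> R"
      using norm_triangle_ineq[of h "c *s v"] that cv[of c] by simp
    then have "z0 + (h + c *s v) \<in> cball z0 (2*R)"
      using R norm_minus_cancel[of "h + c *s v"] by (simp add: dist_norm)
    then show ?thesis using RS by (auto simp: add.assoc)
  qed
  have inS0: "z0 + c *s v \<in> S" if "c \<in> ball 0 r" for c
    using inS[of c 0] that R by simp
  \<comment> \<open>Weierstrass: the difference quotients \<open>F n\<close> in direction
    \<open>h\<close> are holomorphic in \<open>c\<close>, and by \<open>rem\<close> they differ from
    the limit by at most a constant times \<open>t n\<close>, uniformly on the disc.\<close>
  have hol: "(\<lambda>c. pd h f (z0 + c *s v)) holomorphic_on ball 0 r" for h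
  proof (rule holomorphic_uniform_sequence)
    define t where "t n = R / (2 * (norm h + 1)) / real (Suc n)" for n
    have t: "t n > 0" "norm (complex_of_real (t n) *s h) \<le> R/2" for n
    proof -
      show "t n > 0" using R by (simp add: t_def add_nonneg_pos)
      have "t n * norm h \<le> R / (2 * (norm h + 1)) * norm h"
        unfolding t_def using R by (intro mult_right_mono) (auto simp: divide_simps add_nonneg_pos)
      also have "\<dots> \<le> R/2"
        using R by (intro half_step_le) auto
      finally show "norm (complex_of_real (t n) *s h) \<le> R/2"
        using \<open>t n > 0\<close> by (simp add: norm_cvec_smult)
    qed
    define F where "F n c = (f (z0 + complex_of_real (t n) *s h + c *s v) - f (z0 + c *s v)) / complex_of_real (t n)" for n c
    show "F n holomorphic_on ball 0 r" for n
      unfolding F_def using t[of n] inS inS0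
      by (intro holomorphic_intros holo_on_line[OF f]) auto
    have err: "cmod (F n c - pd h f (z0 + c *s v)) \<le> K * (norm h)\<^sup>2 * t n" if c: "c \<in> ball 0 r" for n c
    proof -
      let ?z = "z0 + c *s v" and ?h = "complex_of_real (t n) *s h"
      have "F n c - pd h f ?z = (f (?z + ?h) - f ?z - pd ?h f ?z) / complex_of_real (t n)"
        using t(1)[of n] unfolding F_def pd_smult[OF f inS0[OF c]] by (simp add: field_simps add_ac)
      also have "cmod \<dots> \<le> K * (norm ?h)\<^sup>2 / t n"
        using rem[OF inR[OF c] t(2)[of n]] t(1)[of n] by (simp add: norm_divide divide_right_mono)
      also have "\<dots> = K * (norm h)\<^sup>2 * t n"
        using t(1)[of n] by (simp add: norm_cvec_smult power_mult_distrib power2_eq_square)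
      finally show ?thesis .
    qed
    have "t \<longlonglongrightarrow> 0"
      unfolding t_def
      by (rule real_tendsto_divide_at_top[OF tendsto_const
            filterlim_compose[OF filterlim_real_sequentially filterlim_Suc]])
    then have lim: "(\<lambda>n. K * (norm h)\<^sup>2 * t n) \<longlonglongrightarrow> 0"
      using tendsto_mult_right_zero by blast
    fix x :: complex assume "x \<in> ball 0 r"
    then obtain d where d: "d > 0" "cball x d \<subseteq> ball 0 r"
      using open_contains_cball[of "ball (0::complex) r"] open_ball by blast
    have "uniform_limit (cball x d) F (\<lambda>c. pd h f (z0 + c *s v)) sequentially"
    proof (rule uniform_limitI)
      fix e :: real assume "e > 0"
      then have "\<forall>\<^sub>F n in sequentially. K * (norm h)\<^sup>2 * t n < e"
        using order_tendstoD(2)[OF lim] by blast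
      then show "\<forall>\<^sub>F n in sequentially. \<forall>c\<in>cball x d. dist (F n c) (pd h f (z0 + c *s v)) < e"
        unfolding dist_norm
        by eventually_elim (meson err d(2) le_less_trans subsetD)
    qed
    with d show "\<exists>d>0. cball x d \<subseteq> ball 0 r \<and> uniform_limit (cball x d) F (\<lambda>c. pd h f (z0 + c *s v)) sequentially"
      by blast
  qed auto
  have DE: "((\<lambda>c. pd h f (z0 + c *s v)) has_field_derivative pd v (pd h f) z0) (at 0)" for h
    unfolding pd_def[of v "pd h f"] using hol r by (intro holomorphic_derivI) auto
  \<comment> \<open>Additivity and homogeneity in \<open>h\<close> hold for \<open>pd h f\<close> at
    every point of the line, so they survive differentiation along \<open>v\<close>.\<close>
  have add: "pd v (pd (h + k) f) z0 = pd v (pd h f) z0 + pd v (pd k f) z0" for h k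
  proof -
    have "((\<lambda>c. pd (h + k) f (z0 + c *s v)) has_field_derivative
        (pd v (pd h f) z0 + pd v (pd k f) z0)) (at 0)"
      by (rule has_field_derivative_transform_within_open[OF DERIV_add[OF DE DE], of "ball 0 r"])
        (use r pd_vec_add[OF f inS0] in auto)
    then show ?thesis using DE DERIV_unique by blast
  qed
  show smult: "pd v (pd (a *s h) f) z0 = a * pd v (pd h f) z0" for a h
  proof -
    have "((\<lambda>c. pd (a *s h) f (z0 + c *s v)) has_field_derivative (a * pd v (pd h f) z0)) (at 0)"
      by (rule has_field_derivative_transform_within_open[OF DERIV_cmult[OF DE], of "ball 0 r"])
        (use r pd_smult[OF f inS0] in auto)
    then show ?thesis using DE DERIV_unique by blast
  qed
  have est: "cmod (pd v f (z0 + h) - pd v f z0 - pd v (pd h f) z0) \<le> K * (norm h)\<^sup>2 / (r/2)"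
    if h: "norm h \<le> R/2" for h
  proof -
    \<comment> \<open>The remainder of \<open>f\<close> as a function of the shift \<open>c\<close>.
      It is bounded on the disc of radius \<open>r/2\<close>, and the claim is Cauchy's estimate at
      its centre.\<close>
    let ?g = "\<lambda>c. f (z0 + h + c *s v) - f (z0 + c *s v) - pd h f (z0 + c *s v)"
    have "(?g has_field_derivative (pd v f (z0 + h) - pd v f z0 - pd v (pd h f) z0)) (at 0)"
      using holo_on_DERIV_line[OF f, of "z0 + h" 0 v] holo_on_DERIV_line[OF f, of z0 0 v]
        inS[of 0, OF _ h] inS0[of 0] r
      by (intro DERIV_diff DE) auto
    moreover have "cmod (deriv ?g 0) \<le> K * (norm h)\<^sup>2 / (r/2)"
    proof (rule norm_deriv_le)
      have "cball 0 (r/2) \<subseteq> ball (0::complex) r" using r by auto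
      then show "?g holomorphic_on cball 0 (r/2)"
        using h inS inS0
        by (intro holomorphic_intros holo_on_line[OF f] holomorphic_on_subset[OF hol]) blast+
      show "cmod (?g c) \<le> K * (norm h)\<^sup>2" if "c \<in> cball 0 (r/2)" for c
        using rem[of "z0 + c *s v" h] inR[of c] that h r by (simp add: add_ac)
    qed (use r in auto)
    ultimately show ?thesis by (simp add: DERIV_imp_deriv)
  qed
  show "(pd v f has_derivative (\<lambda>h. pd v (pd h f) z0)) (at z0)"
  proof (rule has_derivativeI_sandwich[where e = "R/2" and H = "\<lambda>y. K / (r/2) * norm (y - z0)"])
    have "linear (\<lambda>h. pd v (pd h f) z0)"
      by (rule linearI) (simp_all add: add smult scaleR_cvec scaleR_conv_of_real)
    then show "bounded_linear (\<lambda>h. pd v (pd h f) z0)"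
      by (simp add: linear_conv_bounded_linear)
    show "norm (pd v f y - pd v f z0 - pd v (pd (y - z0) f) z0) / norm (y - z0) \<le> K / (r/2) * norm (y - z0)"
      if "y \<noteq> z0" "dist y z0 < R/2" for y
      using est[of "y - z0"] that r by (simp add: dist_norm field_simps power2_eq_square)
    show "((\<lambda>y. K / (r/2) * norm (y - z0)) \<longlongrightarrow> 0) (at z0)"
      using r by (auto intro!: tendsto_eq_intros)
  qed (use R in auto)
qed

section \<open>Closure under derivatives, sums and multiples\<close>

lemma holo_on_pd: "holo_on f S \<Longrightarrow> open S \<Longrightarrow> holo_on (pd v f) S"
  unfolding holo_on_def[of "pd v f"] by (blast intro: has_derivative_pd)

text \<open>Symmetry is built into \<open>has_derivative_pd\<close>: the derivative of
  \<open>pd v f\<close> found there is already \<open>pd v (pd u f)\<close> in direction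
  \<open>u\<close>.\<close>

lemma pd_commute:
  assumes "holo_on f S" "open S" "z \<in> S"
  shows "pd u (pd v f) z = pd v (pd u f) z"
  by (rule pd_eqI[OF has_derivative_pd[OF assms]])

lemma pd_cong:
  assumes "holo_on f S" "open S" "z \<in> S" "\<And>x. x \<in> S \<Longrightarrow> g x = f x"
  shows "pd v g z = pd v f z"
proof (rule pd_eqI)
  show "(g has_derivative (\<lambda>v. pd v f z)) (at z)"
    by (rule has_derivative_transform_within_open[OF holo_on_has_derivative[OF assms(1,3)] assms(2,3)])
      (simp add: assms(4))
qed (rule pd_smult[OF assms(1,3)])

lemma holo_on_cong:
  assumes "holo_on f S" "open S" "\<And>x. x \<in> S \<Longrightarrow> g x = f x"
  shows "holo_on g S"
  using assms unfolding holo_on_def by (metis has_derivative_transform_within_open)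

lemma has_derivative_pd_add:
  assumes "holo_on f S" "holo_on g S" "z \<in> S"
  shows "((\<lambda>x. f x + g x) has_derivative (\<lambda>v. pd v f z + pd v g z)) (at z)"
  using assms by (intro has_derivative_add holo_on_has_derivative)

lemma has_derivative_pd_cmult:
  assumes "holo_on f S" "z \<in> S"
  shows "((\<lambda>x. a * f x) has_derivative (\<lambda>v. a * pd v f z)) (at z)"
  using assms by (intro has_derivative_mult_right holo_on_has_derivative)

lemma pd_fun_add:
  assumes "holo_on f S" "holo_on g S" "z \<in> S"
  shows "pd v (\<lambda>x. f x + g x) z = pd v f z + pd v g z"
  by (rule pd_eqI[OF has_derivative_pd_add[OF assms]])
    (simp add: pd_smult[OF assms(1,3)] pd_smult[OF assms(2,3)] algebra_simps)

lemma pd_cmult: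
  assumes "holo_on f S" "z \<in> S"
  shows "pd v (\<lambda>x. a * f x) z = a * pd v f z"
  by (rule pd_eqI[OF has_derivative_pd_cmult[OF assms]]) (simp add: pd_smult[OF assms])

lemma holo_on_add:
  assumes "holo_on f S" "holo_on g S"
  shows "holo_on (\<lambda>x. f x + g x) S"
  unfolding holo_on_def[of "\<lambda>x. f x + g x"]
proof (intro ballI exI conjI allI)
  fix z assume z: "z \<in> S"
  show "((\<lambda>x. f x + g x) has_derivative (\<lambda>v. pd v f z + pd v g z)) (at z)"
    by (rule has_derivative_pd_add[OF assms z])
  show "pd (c *s v) f z + pd (c *s v) g z = c * (pd v f z + pd v g z)" for c v
    by (simp add: pd_smult[OF assms(1) z] pd_smult[OF assms(2) z] distrib_left)
qed

lemma holo_on_cmult: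
  assumes "holo_on f S"
  shows "holo_on (\<lambda>x. a * f x) S"
  unfolding holo_on_def[of "\<lambda>x. a * f x"]
proof (intro ballI exI conjI allI)
  fix z assume z: "z \<in> S"
  show "((\<lambda>x. a * f x) has_derivative (\<lambda>v. a * pd v f z)) (at z)"
    by (rule has_derivative_pd_cmult[OF assms z])
  show "a * pd (c *s v) f z = c * (a * pd v f z)" for c v
    by (simp add: pd_smult[OF assms z])
qed

section \<open>Freezing the antiholomorphic coefficients\<close>

text \<open>Polynomials in \<open>cnj w\<close> with coefficients holomorphic in \<open>z\<close>. The frozen base point \<open>w\<close> is an
  argument of its own; the functions \<open>LL j\<close> acts on are the restrictions to the diagonal.\<close>

inductive polyconj :: "('n::finite) cvec set \<Rightarrow> ('n cvec \<Rightarrow> 'n cvec \<Rightarrow> complex) \<Rightarrow> bool"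
  for S where
  holo: "holo_on g S \<Longrightarrow> polyconj S (\<lambda>z w. g z)"
| add: "polyconj S G \<Longrightarrow> polyconj S H \<Longrightarrow> polyconj S (\<lambda>z w. G z w + H z w)"
| mult: "polyconj S G \<Longrightarrow> polyconj S (\<lambda>z w. a * cnj (w $ k) * G z w)"
| cong: "polyconj S G \<Longrightarrow> (\<And>z w. z \<in> S \<Longrightarrow> H z w = G z w) \<Longrightarrow> polyconj S H"

lemma polyconj_holo_on:
  assumes "polyconj S G" "open S"
  shows "holo_on (\<lambda>z. G z w) S"
  using assms
proof (induction rule: polyconj.induct)
  case (cong G H)
  then show ?case
    by (intro holo_on_cong[of "\<lambda>z. G z w" S "\<lambda>z. H z w"]) auto
qed (auto intro: holo_on_add holo_on_cmult)

lemma polyconj_pd: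
  assumes "polyconj S G" "open S"
  shows "polyconj S (\<lambda>z w. pd v (\<lambda>x. G x w) z)"
  using assms
proof (induction rule: polyconj.induct)
  case (holo g)
  then show ?case by (auto intro!: polyconj.holo holo_on_pd)
next
  case (add G H)
  then show ?case
    by (intro polyconj.cong[OF polyconj.add[OF add.IH]])
      (auto intro!: pd_fun_add polyconj_holo_on)
next
  case (mult G a k)
  then show ?case
    by (intro polyconj.cong[OF polyconj.mult[OF mult.IH, of a k]])
      (auto intro!: pd_cmult polyconj_holo_on)
next
  case (cong G H)
  then show ?case
    by (intro polyconj.cong[OF cong.IH])
      (auto intro!: pd_cong[OF polyconj_holo_on])
qed

text \<open>On the diagonal, differentiating the holomorphic argument gives the complex-linear part,
  with \<open>w\<close> frozen at \<open>z\<close>, and differentiating the factors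
  \<open>cnj (w $ k)\<close> gives a conjugate-linear part \<open>E\<close>. Only the first is seen
  by a Wirtinger derivative.\<close>

lemma polyconj_diagonal:
  assumes "polyconj S G" "open S" "z \<in> S"
  shows "\<exists>E. ((\<lambda>x. G x x) has_derivative (\<lambda>v. pd v (\<lambda>x. G x z) z + E v)) (at z)
    \<and> (\<forall>c v. E (c *s v) = cnj c * E v)"
  using assms
proof (induction rule: polyconj.induct)
  case (holo g)
  then show ?case
    by (intro exI[of _ "\<lambda>_. 0"]) (auto intro: holo_on_has_derivative)
next
  case (add G H)
  then obtain E F where
    "((\<lambda>x. G x x) has_derivative (\<lambda>v. pd v (\<lambda>x. G x z) z + E v)) (at z)"
    "((\<lambda>x. H x x) has_derivative (\<lambda>v. pd v (\<lambda>x. H x z) z + F v)) (at z)"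
    and EF: "\<And>c v. E (c *s v) = cnj c * E v" "\<And>c v. F (c *s v) = cnj c * F v"
    by blast
  from has_derivative_add[OF this(1,2)]
  have "((\<lambda>x. G x x + H x x) has_derivative
      (\<lambda>v. pd v (\<lambda>x. G x z + H x z) z + (E v + F v))) (at z)"
    by (rule has_derivative_eq_rhs)
      (simp add: pd_fun_add[OF polyconj_holo_on[of S G z] polyconj_holo_on[of S H z]]
        add.hyps add.prems fun_eq_iff)
  with EF show ?case
    by (intro exI[of _ "\<lambda>v. E v + F v"]) (auto simp: distrib_left)
next
  case (mult G a k)
  then obtain E where
    G: "((\<lambda>x. G x x) has_derivative (\<lambda>v. pd v (\<lambda>x. G x z) z + E v)) (at z)"
    and E: "\<And>c v. E (c *s v) = cnj c * E v"
    by blast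
  have "((\<lambda>x. cnj (x $ k)) has_derivative (\<lambda>v. cnj (v $ k))) (at z)"
    by (intro bounded_linear_imp_has_derivative bounded_linear_compose[OF bounded_linear_cnj]
        bounded_linear_vec_nth)
  from has_derivative_mult[OF has_derivative_mult_right[OF this, of a] G]
  have "((\<lambda>x. a * cnj (x $ k) * G x x) has_derivative
      (\<lambda>v. pd v (\<lambda>x. a * cnj (z $ k) * G x z) z
        + (a * cnj (z $ k) * E v + a * cnj (v $ k) * G z z))) (at z)"
    by (rule has_derivative_eq_rhs)
      (simp add: pd_cmult[OF polyconj_holo_on[of S G z]] mult.hyps mult.prems fun_eq_iff,
        simp add: algebra_simps)
  with E show ?case
    by (intro exI[of _ "\<lambda>v. a * cnj (z $ k) * E v + a * cnj (v $ k) * G z z"])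
      (auto simp: algebra_simps)
next
  case (cong G H)
  then obtain E where
    G: "((\<lambda>x. G x x) has_derivative (\<lambda>v. pd v (\<lambda>x. G x z) z + E v)) (at z)"
    and E: "\<And>c v. E (c *s v) = cnj c * E v"
    by blast
  have "pd v (\<lambda>x. H x z) z = pd v (\<lambda>x. G x z) z" for v
    using cong by (intro pd_cong[OF polyconj_holo_on]) auto
  moreover have "((\<lambda>x. H x x) has_derivative (\<lambda>v. pd v (\<lambda>x. G x z) z + E v)) (at z)"
    using cong by (intro has_derivative_transform_within_open[OF G]) auto
  ultimately show ?case using E by auto
qed

section \<open>Iterated \<open>LL j\<close> as iterated frozen directional derivatives\<close>

lemma axis_eq_smult: "axis j c = c *s (axis j 1 :: ('n::finite) cvec)"
  by (simp add: vec_eq_iff axis_def)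

text \<open>Replacing \<open>v\<close> by \<open>\<i> *s v\<close> multiplies \<open>A v\<close> by
  \<open>\<i>\<close> and \<open>E v\<close> by \<open>- \<i>\<close>, so the combination in
  \<open>wirtinger\<close> doubles \<open>A\<close> and cancels \<open>E\<close>.\<close>

lemma wirtinger_eqI:
  assumes H: "(H has_derivative (\<lambda>v. A v + E v)) (at z)"
    and A: "\<And>c v. A (c *s v) = c * A v" and E: "\<And>c v. E (c *s v) = cnj c * E v"
  shows "wirtinger j H z = A (axis j 1)"
proof -
  have *: "vector_derivative (\<lambda>t::real. H (z + of_real t *s v)) (at 0) = A v + E v" for v
  proof -
    have line: "((\<lambda>t. z + t *\<^sub>R v) has_derivative (\<lambda>t. t *\<^sub>R v)) (at 0)"
      by (auto intro!: derivative_eq_intros)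
    have "((\<lambda>t. H (z + t *\<^sub>R v)) has_derivative (\<lambda>t. A (t *\<^sub>R v) + E (t *\<^sub>R v))) (at 0)"
      by (rule has_derivative_compose[OF line]) (use H in simp)
    then have "((\<lambda>t. H (z + t *\<^sub>R v)) has_vector_derivative (A v + E v)) (at 0)"
      unfolding has_vector_derivative_def
      by (rule has_derivative_eq_rhs)
        (simp add: scaleR_cvec A E fun_eq_iff scaleR_conv_of_real algebra_simps)
    then show ?thesis unfolding scaleR_cvec by (rule vector_derivative_at)
  qed
  have "wirtinger j H z = ((A (axis j 1) + E (axis j 1)) - \<i> * (A (\<i> *s axis j 1) + E (\<i> *s axis j 1))) / 2"
    unfolding wirtinger_def *[symmetric] axis_eq_smult[of j "of_real _"] axis_eq_smult[of j "_ * of_real _"]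
    by (simp add: mult.commute)
  then show ?thesis unfolding A E by (simp add: algebra_simps)
qed

text \<open>The vector field of \<open>LL j\<close> with its coefficient frozen at \<open>w\<close>.
  For \<open>j\<close> other than \<open>last_ix\<close> it is complex tangent at \<open>w\<close>
  to the level set of \<open>rho\<close> through \<open>w\<close>.\<close>

definition hvec :: "'n \<Rightarrow> ('n::{finite,linorder}) cvec \<Rightarrow> 'n cvec" where
  "hvec j w = (if j = last_ix then axis last_ix 1
     else axis j 1 + (2 * \<i> * cnj (w $ j)) *s axis last_ix 1)"

lemma pd_hvec:
  assumes "holo_on f S" "z \<in> S"
  shows "pd (hvec j w) f z = (if j = last_ix then pd (axis last_ix 1) f z
     else pd (axis j 1) f z + 2 * \<i> * cnj (w $ j) * pd (axis last_ix 1) f z)"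
  by (simp add: hvec_def pd_vec_add[OF assms] pd_smult[OF assms])

lemma polyconj_pd_hvec:
  assumes "polyconj S G" "open S"
  shows "polyconj S (\<lambda>z w. pd (hvec j w) (\<lambda>x. G x w) z)"
proof (cases "j = last_ix")
  case True
  then show ?thesis using polyconj_pd[OF assms] by (simp add: hvec_def)
next
  case False
  then show ?thesis
    by (intro polyconj.cong[OF polyconj.add[OF polyconj_pd[OF assms, of "axis j 1"]
        polyconj.mult[OF polyconj_pd[OF assms, of "axis last_ix 1"], of "2 * \<i>" j]]])
      (simp add: pd_hvec[OF polyconj_holo_on[OF assms]])
qed

text \<open>At the point \<open>z\<close> the coefficient of \<open>LL j\<close> equals the one
  frozen at \<open>w = z\<close>, and the conjugate-linear part drops out. Agreement of
  \<open>H\<close> with the diagonal is asked only on \<open>S\<close>, which is what an iteration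
  can provide.\<close>

lemma LL_diagonal:
  assumes "polyconj S G" "open S" "z \<in> S" "\<And>x. x \<in> S \<Longrightarrow> H x = G x x"
  shows "LL j H z = pd (hvec j z) (\<lambda>x. G x z) z"
proof -
  obtain E where G: "((\<lambda>x. G x x) has_derivative (\<lambda>v. pd v (\<lambda>x. G x z) z + E v)) (at z)"
    and E: "\<And>c v. E (c *s v) = cnj c * E v"
    using polyconj_diagonal[OF assms(1-3)] by blast
  have "(H has_derivative (\<lambda>v. pd v (\<lambda>x. G x z) z + E v)) (at z)"
    using assms by (intro has_derivative_transform_within_open[OF G]) auto
  from wirtinger_eqI[OF this pd_smult[OF polyconj_holo_on[OF assms(1,2)] assms(3)] E]
  show ?thesis
    by (simp add: LL_def pd_hvec[OF polyconj_holo_on[OF assms(1,2)] assms(3)])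
qed

text \<open>The induction carries both claims: the \<open>polyconj\<close> form of the inner word is
  what allows \<open>LL_diagonal\<close> to be applied to the next operator.\<close>

lemma foldr_LL:
  assumes f: "holo_on f S" and S: "open S"
  shows "polyconj S (\<lambda>z w. foldr (\<lambda>j. pd (hvec j w)) js f z)"
    and "z \<in> S \<Longrightarrow> foldr LL js f z = foldr (\<lambda>j. pd (hvec j z)) js f z"
proof -
  have "polyconj S (\<lambda>z w. foldr (\<lambda>j. pd (hvec j w)) js f z)
      \<and> (\<forall>z\<in>S. foldr LL js f z = foldr (\<lambda>j. pd (hvec j z)) js f z)"
  proof (induction js)
    case Nil
    then show ?case using f by (simp add: polyconj.holo)
  next
    case (Cons j js)
    then show ?case
      using polyconj_pd_hvec[of S _ j] LL_diagonal[of S _ _ _ j] S by auto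
  qed
  then show "polyconj S (\<lambda>z w. foldr (\<lambda>j. pd (hvec j w)) js f z)"
    "z \<in> S \<Longrightarrow> foldr LL js f z = foldr (\<lambda>j. pd (hvec j z)) js f z" by auto
qed

lemma holo_on_foldr_pd:
  assumes "holo_on f S" "open S"
  shows "holo_on (foldr (\<lambda>j. pd (hvec j w)) js f) S"
  by (induction js) (auto intro: holo_on_pd assms)

section \<open>Cauchy estimates on sheared polydiscs\<close>

text \<open>The share of one factor \<open>LL j\<close> in \<open>mi_weight\<close>;
  \<open>rho w powr wt j\<close> is the natural length scale in direction
  \<open>hvec j w\<close>.\<close>

definition wt :: "'n::{finite,linorder} \<Rightarrow> real" where
  "wt j = (if j = last_ix then 1 else 1 / 2)"

definition shear :: "('n::{finite,linorder}) cvec \<Rightarrow> 'n cvec \<Rightarrow> complex" where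
  "shear w z = z $ last_ix - w $ last_ix - 2 * \<i> * (\<Sum>j\<in>UNIV - {last_ix}. cnj (w $ j) * (z $ j - w $ j))"

text \<open>In the coordinates \<open>z' - w'\<close> and \<open>shear w z\<close>, which translate \<open>w\<close> to the origin by the
  Heisenberg group, the vectors \<open>hvec j w\<close> are the coordinate directions.\<close>

definition hpolydisc :: "('n::{finite,linorder}) cvec \<Rightarrow> real \<Rightarrow> 'n cvec set" where
  "hpolydisc w r = {z. (\<forall>j. j \<noteq> last_ix \<longrightarrow> cmod (z $ j - w $ j) \<le> r * rho w powr (1/2))
     \<and> cmod (shear w z) \<le> r * rho w}"

text \<open>Heisenberg invariance of \<open>rho\<close>: expanding the squared norm of
  \<open>z'\<close> around \<open>w'\<close>, the linear terms are absorbed by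
  \<open>Im (shear w z)\<close> and only the squares of the increments remain.\<close>

lemma rho_shear:
  "rho z = rho w - (\<Sum>j\<in>UNIV - {last_ix}. (cmod (z $ j - w $ j))\<^sup>2) + Im (shear w z)"
proof -
  have *: "(cmod (z $ j))\<^sup>2 = (cmod (w $ j))\<^sup>2 + 2 * Re (cnj (w $ j) * (z $ j - w $ j)) + (cmod (z $ j - w $ j))\<^sup>2" for j
    by (simp add: cmod_power2) (simp add: power2_eq_square algebra_simps)
  have "Im (shear w z) = Im (z $ last_ix) - Im (w $ last_ix)
      - (\<Sum>j\<in>UNIV - {last_ix}. 2 * Re (cnj (w $ j) * (z $ j - w $ j)))"
    by (simp add: shear_def sum_distrib_left)
  moreover have "(\<Sum>j\<in>UNIV - {last_ix}. (cmod (z $ j))\<^sup>2)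
      = (\<Sum>j\<in>UNIV - {last_ix}. (cmod (w $ j))\<^sup>2)
        + (\<Sum>j\<in>UNIV - {last_ix}. 2 * Re (cnj (w $ j) * (z $ j - w $ j)))
        + (\<Sum>j\<in>UNIV - {last_ix}. (cmod (z $ j - w $ j))\<^sup>2)"
    unfolding sum.distrib[symmetric] by (rule sum.cong[OF refl *])
  ultimately show ?thesis
    unfolding rho_def by linarith
qed

text \<open>In \<open>rho_shear\<close> the squares cost at most
  \<open>n * r\<^sup>2 * rho w \<le> rho w / 4\<close>, where n is the dimension, and the shear term
  at most \<open>rho w / 2\<close>; a quarter of \<open>rho w\<close> is left.\<close>

lemma rho_hpolydisc:
  fixes w z :: "('n::{finite,linorder}) cvec"
  assumes w: "w \<in> siegel" and r: "0 \<le> r" "r \<le> 1 / (2 * CARD('n))" and z: "z \<in> hpolydisc w r"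
  shows "rho w / 4 \<le> rho z"
proof -
  let ?n = "real CARD('n)"
  have n: "?n \<ge> 1" by (simp add: Suc_leI)
  have rw: "rho w > 0" using w by (simp add: siegel_def)
  have nr: "?n * r \<le> 1/2" using r n by (simp add: field_simps)
  then have r2: "r \<le> 1/2" using r n mult_right_mono[of 1 ?n r] by linarith
  have "(\<Sum>j\<in>UNIV - {last_ix}. (cmod (z $ j - w $ j))\<^sup>2) \<le> (\<Sum>j\<in>(UNIV - {last_ix} :: 'n set). r\<^sup>2 * rho w)"
  proof (rule sum_mono)
    fix j :: 'n assume "j \<in> UNIV - {last_ix}"
    then have "cmod (z $ j - w $ j) \<le> r * rho w powr (1/2)"
      using z by (simp add: hpolydisc_def)
    then have "(cmod (z $ j - w $ j))\<^sup>2 \<le> (r * rho w powr (1/2))\<^sup>2"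
      by (intro power_mono) auto
    then show "(cmod (z $ j - w $ j))\<^sup>2 \<le> r\<^sup>2 * rho w"
      using rw by (simp add: power_mult_distrib powr_half_sqrt)
  qed
  also have "\<dots> \<le> ?n * (r\<^sup>2 * rho w)"
    using rw by (simp add: mult_right_mono card_mono)
  also have "\<dots> = (?n * r) * (r * rho w)"
    by (simp add: power2_eq_square)
  also have "\<dots> \<le> 1/2 * (1/2 * rho w)"
    using nr r2 r rw by (intro mult_mono) auto
  finally have 1: "(\<Sum>j\<in>UNIV - {last_ix}. (cmod (z $ j - w $ j))\<^sup>2) \<le> rho w / 4" by simp
  have "\<bar>Im (shear w z)\<bar> \<le> r * rho w"
    using z abs_Im_le_cmod[of "shear w z"] by (simp add: hpolydisc_def)
  also have "\<dots> \<le> 1/2 * rho w"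
    using r2 rw by (intro mult_right_mono) auto
  finally show ?thesis using 1 unfolding rho_shear[of z w] by linarith
qed

lemma hpolydisc_subset_siegel:
  fixes w :: "('n::{finite,linorder}) cvec"
  assumes "w \<in> siegel" "0 \<le> r" "r \<le> 1 / (2 * CARD('n))"
  shows "hpolydisc w r \<subseteq> siegel"
proof
  fix z assume "z \<in> hpolydisc w r"
  from rho_hpolydisc[OF assms this] show "z \<in> siegel"
    using assms(1) by (simp add: siegel_def)
qed

lemma hvec_nth:
  "hvec j w $ k = (if k = last_ix then (if j = last_ix then 1 else 2 * \<i> * cnj (w $ j))
     else if k = j then 1 else 0)"
  by (auto simp: hvec_def axis_def)

text \<open>For tangential \<open>j\<close> the last component of \<open>hvec j w\<close> cancels
  the increment of the sum in \<open>shear\<close>.\<close>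

lemma shear_line: "shear w (z + c *s hvec j w) = shear w z + (if j = last_ix then c else 0)"
proof -
  have "(\<Sum>k\<in>UNIV - {last_ix}. cnj (w $ k) * ((z + c *s hvec j w) $ k - w $ k))
     = (\<Sum>k\<in>UNIV - {last_ix}. cnj (w $ k) * (z $ k - w $ k) + (if k = j then c * cnj (w $ j) else 0))"
    by (rule sum.cong) (auto simp: hvec_nth algebra_simps)
  also have "\<dots> = (\<Sum>k\<in>UNIV - {last_ix}. cnj (w $ k) * (z $ k - w $ k))
      + (if j = last_ix then 0 else c * cnj (w $ j))"
    by (simp add: sum.distrib)
  finally show ?thesis
    by (simp add: shear_def hvec_nth algebra_simps)
qed

lemma hpolydisc_line:
  fixes s t :: real
  assumes z: "z \<in> hpolydisc w t" and c: "cmod c \<le> s * rho w powr wt j" and w: "w \<in> siegel" and s: "0 \<le> s"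
  shows "z + c *s hvec j w \<in> hpolydisc w (t + s)"
  unfolding hpolydisc_def
proof (intro CollectI conjI allI impI)
  have rw: "rho w > 0" using w by (simp add: siegel_def)
  show "cmod ((z + c *s hvec j w) $ k - w $ k) \<le> (t + s) * rho w powr (1/2)" if k: "k \<noteq> last_ix" for k
  proof -
    have "cmod (c * hvec j w $ k) \<le> s * rho w powr (1/2)"
      using c k s by (auto simp: hvec_nth norm_mult wt_def)
    moreover have "cmod (z $ k - w $ k) \<le> t * rho w powr (1/2)"
      using z k by (simp add: hpolydisc_def)
    ultimately show ?thesis
      using norm_triangle_ineq[of "z $ k - w $ k" "c * hvec j w $ k"]
      by (simp add: algebra_simps)
  qed
  have "cmod (shear w z) \<le> t * rho w"
    using z by (simp add: hpolydisc_def)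
  moreover have "cmod (if j = last_ix then c else 0) \<le> s * rho w"
    using c s rw by (auto simp: wt_def)
  ultimately show "cmod (shear w (z + c *s hvec j w)) \<le> (t + s) * rho w"
    unfolding shear_line using norm_triangle_ineq[of "shear w z" "if j = last_ix then c else 0"]
    by (simp add: distrib_right)
qed

lemma center_in_hpolydisc: "w \<in> siegel \<Longrightarrow> 0 \<le> r \<Longrightarrow> w \<in> hpolydisc w r"
  by (simp add: hpolydisc_def shear_def siegel_def)

lemma hpolydisc_mono:
  assumes "w \<in> siegel" "r \<le> s" shows "hpolydisc w r \<subseteq> hpolydisc w s"
proof -
  have "r * rho w powr (1/2) \<le> s * rho w powr (1/2)" "r * rho w \<le> s * rho w"
    using assms by (auto intro!: mult_right_mono simp: siegel_def)
  then show ?thesis by (force simp: hpolydisc_def)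
qed

lemma open_siegel: "open (siegel :: ('n::{finite,linorder}) cvec set)"
proof -
  have "continuous_on UNIV (rho :: 'n cvec \<Rightarrow> real)"
    unfolding rho_def by (intro continuous_intros)
  then show ?thesis
    unfolding siegel_def by (intro open_Collect_less) auto
qed

text \<open>Each derivative spends \<open>s\<close> of the polydisc radius: Cauchy's estimate on a
  disc of radius \<open>s * rho w powr wt j\<close> around a point of \<open>hpolydisc w t\<close>
  needs the inner function only on \<open>hpolydisc w (t + s)\<close>. Hence \<open>t\<close> varies
  in the induction, while directions and scales stay frozen at \<open>w\<close>.\<close>

lemma foldr_pd_bound:
  fixes g :: "('n::{finite,linorder}) cvec \<Rightarrow> complex" and s t :: real
  assumes g: "holo_on g siegel" and w: "w \<in> siegel" and s: "0 < s"
    and t: "0 \<le> t" "t + length js * s \<le> 1 / (2 * CARD('n))"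
    and A: "\<And>z. z \<in> hpolydisc w (t + length js * s) \<Longrightarrow> cmod (g z) \<le> A"
    and z: "z \<in> hpolydisc w t"
  shows "cmod (foldr (\<lambda>j. pd (hvec j w)) js g z) \<le> A / (s ^ length js * rho w powr (sum_list (map wt js)))"
  using t A z
proof (induction js arbitrary: t z)
  case Nil
  then show ?case using w by (simp add: siegel_def)
next
  case (Cons j js)
  have rw: "rho w > 0" using w by (simp add: siegel_def)
  have e: "t + s + length js * s = t + length (j # js) * s"
    by (simp add: algebra_simps)
  have IH: "cmod (foldr (\<lambda>j. pd (hvec j w)) js g y) \<le> A / (s ^ length js * rho w powr (sum_list (map wt js)))"
    if "y \<in> hpolydisc w (t + s)" for y
    using Cons.IH[of "t + s" y] Cons.prems s that unfolding e by simp
  have ts: "t + s \<le> 1 / (2 * CARD('n))"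
    using Cons.prems(2) s mult_nonneg_nonneg[of "real (length js)" s] unfolding e[symmetric] by linarith
  have "cmod (pd (hvec j w) (foldr (\<lambda>j. pd (hvec j w)) js g) z)
      \<le> A / (s ^ length js * rho w powr (sum_list (map wt js))) / (s * rho w powr wt j)"
  proof (rule norm_pd_le[OF holo_on_foldr_pd[OF g open_siegel]])
    fix c assume "cmod c \<le> s * rho w powr wt j"
    from hpolydisc_line[OF Cons.prems(4) this w] s have *: "z + c *s hvec j w \<in> hpolydisc w (t + s)"
      by simp
    then show "z + c *s hvec j w \<in> siegel \<and> cmod (foldr (\<lambda>j. pd (hvec j w)) js g (z + c *s hvec j w))
        \<le> A / (s ^ length js * rho w powr (sum_list (map wt js)))"
      using IH hpolydisc_subset_siegel[OF w _ ts] s Cons.prems(1) by auto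
  qed (use s rw in auto)
  also have "\<dots> = A / (s ^ length (j # js) * rho w powr (sum_list (map wt (j # js))))"
    by (simp add: powr_add)
  finally show ?case by simp
qed

section \<open>Weighted derivatives bounded by the Bloch norm\<close>

lemma norm_LL_le_inv_grad:
  assumes z: "z \<in> siegel"
  shows "cmod (LL j f z) \<le> inv_grad f z * rho z powr (- wt j)"
proof -
  have rz: "rho z > 0" using z by (simp add: siegel_def)
  let ?S = "\<Sum>j\<in>UNIV - {last_ix}. (cmod (LL j f z))\<^sup>2"
  have S: "0 \<le> ?S" by (intro sum_nonneg) auto
  have "(rho z powr wt j * cmod (LL j f z))\<^sup>2 \<le> 2 * rho z * ?S + 8 * (rho z)\<^sup>2 * (cmod (LL last_ix f z))\<^sup>2"
  proof (cases "j = last_ix")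
    case True
    have "0 \<le> rho z * ?S" "0 \<le> (rho z)\<^sup>2 * (cmod (LL last_ix f z))\<^sup>2"
      using rz S by auto
    moreover have "(rho z powr wt j * cmod (LL j f z))\<^sup>2 = (rho z)\<^sup>2 * (cmod (LL last_ix f z))\<^sup>2"
      using True rz by (simp add: wt_def power_mult_distrib)
    ultimately show ?thesis by linarith
  next
    case False
    have "(cmod (LL j f z))\<^sup>2 \<le> ?S"
      using False by (intro member_le_sum) auto
    then have "rho z * (cmod (LL j f z))\<^sup>2 \<le> rho z * ?S" "0 \<le> rho z * ?S"
      using rz S by auto
    moreover have "0 \<le> (rho z)\<^sup>2 * (cmod (LL last_ix f z))\<^sup>2" by simp
    moreover have "(rho z powr wt j * cmod (LL j f z))\<^sup>2 = rho z * (cmod (LL j f z))\<^sup>2"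
      using False rz by (simp add: wt_def power_mult_distrib powr_half_sqrt)
    ultimately show ?thesis by linarith
  qed
  then have "rho z powr wt j * cmod (LL j f z) \<le> inv_grad f z"
    unfolding inv_grad_def by (rule real_le_rsqrt)
  then show ?thesis using rz by (simp add: powr_minus field_simps)
qed

text \<open>The direction is frozen at \<open>w\<close> but the derivative is taken at
  \<open>z\<close>, so it differs from \<open>LL j f z\<close> by a multiple of
  \<open>LL last_ix f z\<close>. The coefficient has size \<open>sqrt (rho w)\<close>, which brings
  \<open>1 / rho w\<close> down to the right order.\<close>

lemma norm_pd_hvec_le:
  fixes f :: "('n::{finite,linorder}) cvec \<Rightarrow> complex" and B :: real
  assumes f: "holo_on f siegel" and B: "\<And>z. z \<in> siegel \<Longrightarrow> inv_grad f z \<le> B"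
    and w: "w \<in> siegel" and z: "z \<in> hpolydisc w (1 / (2 * CARD('n)))"
  shows "cmod (pd (hvec j w) f z) \<le> 6 * B / rho w powr wt j"
proof -
  let ?r = "1 / real (2 * CARD('n))"
  have n: "real CARD('n) \<ge> 1" by (simp add: Suc_leI)
  have r: "0 \<le> ?r" "?r \<le> 1/2" using n by (auto simp: field_simps)
  have rw: "rho w > 0" using w by (simp add: siegel_def)
  have rz4: "rho w / 4 \<le> rho z" by (rule rho_hpolydisc[OF w r(1) order_refl z])
  then have zs: "z \<in> siegel" and rz: "rho z > 0" using rw by (auto simp: siegel_def)
  have B0: "0 \<le> B"
    using order_trans[OF _ B[OF w]] rw
    by (simp add: inv_grad_def sum_nonneg)
  have LL: "LL k f z = pd (hvec k z) f z" for k
    using foldr_LL(2)[OF f open_siegel zs, of "[k]"] by simp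
  have bnd: "cmod (LL k f z) \<le> B / rho z powr wt k" for k
  proof -
    have "cmod (LL k f z) \<le> inv_grad f z * rho z powr (- wt k)"
      by (rule norm_LL_le_inv_grad[OF zs])
    also have "\<dots> \<le> B * rho z powr (- wt k)"
      using B[OF zs] by (intro mult_right_mono) auto
    finally show ?thesis by (simp add: powr_minus field_simps)
  qed
  have "B / rho z \<le> B / (rho w / 4)"
    using B0 rw rz rz4 by (intro divide_left_mono) auto
  then have last: "cmod (LL last_ix f z) \<le> 4 * B / rho w"
    using bnd[of last_ix] rz by (simp add: wt_def mult.commute)
  show ?thesis
  proof (cases "j = last_ix")
    case True
    have "4 * B / rho w \<le> 6 * B / rho w"
      using B0 rw by (intro divide_right_mono) auto
    with True show ?thesis using last rw LL[of last_ix]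
      by (simp add: wt_def hvec_def)
  next
    case False
    have rs: "sqrt (rho w) > 0" using rw by simp
    have ss: "sqrt (rho w) * sqrt (rho w) = rho w" using rw by simp
    have "sqrt (rho w) / 2 \<le> sqrt (rho z)"
      using real_sqrt_le_mono[OF rz4] by (simp add: real_sqrt_divide)
    then have "B / sqrt (rho z) \<le> B / (sqrt (rho w) / 2)"
      using B0 rw rz by (intro divide_left_mono) auto
    then have 1: "cmod (LL j f z) \<le> 2 * B / sqrt (rho w)"
      using bnd[of j] rz False by (simp add: wt_def powr_half_sqrt mult.commute)
    have "cmod (z $ j - w $ j) \<le> ?r * sqrt (rho w)"
      using z False rw by (simp add: hpolydisc_def powr_half_sqrt)
    also have "\<dots> \<le> 1/2 * sqrt (rho w)"
      using r rw by (intro mult_right_mono) auto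
    finally have wz: "cmod (cnj (w $ j) - cnj (z $ j)) \<le> sqrt (rho w) / 2"
      by (metis complex_cnj_diff complex_mod_cnj mult.commute norm_minus_commute times_divide_eq_right mult_1_right)
    \<comment> \<open>The first term contributes \<open>2 * B\<close> and the correction
      \<open>4 * B\<close>, both over \<open>sqrt (rho w)\<close>; this is the constant 6.\<close>
    have "pd (hvec j w) f z = LL j f z + 2 * \<i> * (cnj (w $ j) - cnj (z $ j)) * LL last_ix f z"
      using False unfolding LL pd_hvec[OF f zs] by (simp add: algebra_simps)
    then have "cmod (pd (hvec j w) f z)
        \<le> cmod (LL j f z) + 2 * cmod (cnj (w $ j) - cnj (z $ j)) * cmod (LL last_ix f z)"
      using norm_triangle_ineq[of "LL j f z" "2 * \<i> * (cnj (w $ j) - cnj (z $ j)) * LL last_ix f z"]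
      by (simp add: norm_mult)
    also have "\<dots> \<le> 2 * B / sqrt (rho w) + 2 * (sqrt (rho w) / 2) * (4 * B / rho w)"
      using wz 1 last rs rw by (intro add_mono mult_mono) auto
    also have "2 * (sqrt (rho w) / 2) * (4 * B / rho w) = 4 * B / sqrt (rho w)"
      using rs by (subst ss[symmetric]) (simp add: field_simps del: real_sqrt_mult_self)
    also have "2 * B / sqrt (rho w) + 4 * B / sqrt (rho w) = 6 * B / sqrt (rho w)"
      by (simp add: add_divide_distrib[symmetric])
    finally show ?thesis using False rw by (simp add: wt_def powr_half_sqrt)
  qed
qed

text \<open>The Bloch norm bounds first derivatives but not \<open>f\<close> itself. So the
  innermost operator is estimated by \<open>norm_pd_hvec_le\<close>, and Cauchy's estimates are used
  only for the others.\<close>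

lemma norm_foldr_LL_le:
  fixes f :: "('n::{finite,linorder}) cvec \<Rightarrow> complex" and B :: real
  assumes f: "holo_on f siegel" and B: "\<And>z. z \<in> siegel \<Longrightarrow> inv_grad f z \<le> B"
    and w: "w \<in> siegel" and js: "js \<noteq> []"
  shows "cmod (foldr LL js f w)
    \<le> 6 * (2 * CARD('n) * length js) ^ (length js - 1) * B / rho w powr (sum_list (map wt js))"
proof -
  obtain ks j where ksj: "js = ks @ [j]" using js by (metis rev_exhaust)
  \<comment> \<open>With this step even \<open>length js\<close> derivatives stay within the
    admissible radius \<open>1 / (2 * CARD('n))\<close>.\<close>
  define s where "s = 1 / (2 * real CARD('n) * length js)"
  have s: "s > 0" using js by (simp add: s_def)
  have rw: "rho w > 0" using w by (simp add: siegel_def)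
  have "length ks * s \<le> length js * s"
    using s ksj by (intro mult_right_mono) auto
  also have "\<dots> = 1 / (2 * CARD('n))"
    using js by (simp add: s_def)
  finally have le: "length ks * s \<le> 1 / (2 * CARD('n))" .
  have "cmod (foldr (\<lambda>j. pd (hvec j w)) ks (pd (hvec j w) f) w)
      \<le> 6 * B / rho w powr wt j / (s ^ length ks * rho w powr (sum_list (map wt ks)))"
  proof (rule foldr_pd_bound[where t = 0])
    show "cmod (pd (hvec j w) f z) \<le> 6 * B / rho w powr wt j"
      if "z \<in> hpolydisc w (0 + length ks * s)" for z
      using norm_pd_hvec_le[OF f B w] hpolydisc_mono[OF w le] that by auto
  qed (use s w le in \<open>auto intro: holo_on_pd[OF f open_siegel] center_in_hpolydisc\<close>)
  also have "\<dots> = 6 * (2 * CARD('n) * length js) ^ (length js - 1) * B / rho w powr (sum_list (map wt js))"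
    by (simp add: ksj s_def powr_add power_divide, simp add: algebra_simps)
  finally show ?thesis
    unfolding foldr_LL(2)[OF f open_siegel w] by (simp add: ksj)
qed

section \<open>Integration along vertical rays\<close>

lemma rho_vertical: "rho (w + c *s axis last_ix 1) = rho w + Im c"
  by (simp add: rho_def axis_def)

text \<open>The hypothesis \<open>dec\<close> serves only to make \<open>g\<close> vanish at the end
  of the ray: \<open>K\<close> and \<open>b\<close> disappear in the limit, and the final bound
  depends on \<open>M\<close> and \<open>a\<close> alone.\<close>

lemma norm_le_vertical_derivative:
  fixes g :: "('n::{finite,linorder}) cvec \<Rightarrow> complex"
  assumes g: "holo_on g siegel" and w: "w \<in> siegel" and a: "0 < a" and b: "0 < b"
    and der: "\<And>t. 0 \<le> t \<Longrightarrow> cmod (pd (axis last_ix 1) g (w + (\<i> * of_real t) *s axis last_ix 1))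
      \<le> M / (rho w + t) powr (a + 1)"
    and dec: "\<And>t. 0 \<le> t \<Longrightarrow> cmod (g (w + (\<i> * of_real t) *s axis last_ix 1)) \<le> K / (rho w + t) powr b"
  shows "cmod (g w) \<le> M / a / rho w powr a"
proof -
  let ?e = "axis last_ix 1 :: 'n cvec"
  have rw: "rho w > 0" using w by (simp add: siegel_def)
  have S: "w + (\<i> * of_real t) *s ?e \<in> siegel" if "0 \<le> t" for t
    using rw that by (simp add: siegel_def rho_vertical)
  define \<phi> where "\<phi> t = g (w + (\<i> * of_real t) *s ?e)" for t
  \<comment> \<open>An increasing antiderivative of the majorant in \<open>der\<close>, vanishing at
    infinity; \<open>- \<psi> 0\<close> is the claimed bound.\<close>
  define \<psi> where "\<psi> t = - (M / a) * (rho w + t) powr (- a)" for t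
  have d\<phi>: "(\<phi> has_vector_derivative \<i> * pd ?e g (w + (\<i> * of_real t) *s ?e)) (at t)" if "0 \<le> t" for t
  proof -
    have "((\<lambda>t. \<i> * complex_of_real t) has_vector_derivative \<i>) (at t)"
      by (auto intro!: derivative_eq_intros)
    from field_vector_diff_chain_at[OF this holo_on_DERIV_line[OF g S[OF that]]]
    show ?thesis by (simp add: \<phi>_def[abs_def] o_def)
  qed
  have d\<psi>: "(\<psi> has_vector_derivative M / (rho w + t) powr (a + 1)) (at t)" if "0 \<le> t" for t
  proof -
    have "(\<psi> has_real_derivative - (M / a) * (- a * (rho w + t) powr (- a - 1))) (at t)"
      unfolding \<psi>_def[abs_def] using rw that
      by (auto intro!: derivative_eq_intros)
    also have "- (M / a) * (- a * (rho w + t) powr (- a - 1)) = M / (rho w + t) powr (a + 1)"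
      using a powr_minus[of "rho w + t" "a + 1"] by (simp add: divide_inverse)
    finally show ?thesis by (simp add: has_real_derivative_iff_has_vector_derivative)
  qed
  have M: "0 \<le> M"
    using order_trans[OF norm_ge_zero der[of 0]] rw by (simp add: zero_le_divide_iff)
  have bound: "cmod (\<phi> 0) \<le> M / a / rho w powr a + K / (rho w + T) powr b" if T: "0 < T" for T
  proof -
    have "norm (\<phi> T - \<phi> 0) \<le> \<psi> T - \<psi> 0"
    proof (rule differentiable_bound_general[OF T])
      show "continuous_on {0..T} \<phi>"
        by (rule continuous_at_imp_continuous_on) (auto intro!: has_vector_derivative_continuous d\<phi>)
      show "continuous_on {0..T} \<psi>"
        by (rule continuous_at_imp_continuous_on) (auto intro!: has_vector_derivative_continuous d\<psi>)
      fix t assume t: "0 < t" "t < T"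
      show "(\<phi> has_vector_derivative \<i> * pd ?e g (w + (\<i> * of_real t) *s ?e)) (at t)"
        using d\<phi> t by simp
      show "(\<psi> has_vector_derivative M / (rho w + t) powr (a + 1)) (at t)"
        using d\<psi> t by simp
      show "cmod (\<i> * pd ?e g (w + (\<i> * of_real t) *s ?e)) \<le> M / (rho w + t) powr (a + 1)"
        using der[of t] t by (simp add: norm_mult)
    qed
    moreover have "\<psi> T \<le> 0" "- \<psi> 0 = M / a / rho w powr a"
      using M a by (auto simp: \<psi>_def powr_minus divide_inverse)
    moreover have "cmod (\<phi> T) \<le> K / (rho w + T) powr b"
      using dec[of T] T by (simp add: \<phi>_def)
    ultimately show ?thesis
      using norm_triangle_sub[of "\<phi> 0" "\<phi> T"] by (simp add: norm_minus_commute)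
  qed
  have "((\<lambda>T. M / a / rho w powr a + K * (rho w + T) powr (- b)) \<longlongrightarrow> M / a / rho w powr a + K * 0) at_top"
    by (intro tendsto_intros tendsto_neg_powr filterlim_tendsto_add_at_top[OF tendsto_const filterlim_ident])
      (use b in auto)
  moreover have "\<forall>\<^sub>F T in at_top. cmod (\<phi> 0) \<le> M / a / rho w powr a + K * (rho w + T) powr (- b)"
    using eventually_gt_at_top[of 0]
    by eventually_elim (use bound in \<open>simp add: powr_minus divide_inverse\<close>)
  ultimately have "cmod (\<phi> 0) \<le> M / a / rho w powr a + K * 0"
    by (intro tendsto_lowerbound) auto
  then show ?thesis by (simp add: \<phi>_def)
qed

section \<open>The invariant gradient controlled by a power of \<open>LL last_ix\<close>\<close>

lemma hvec_last [simp]: "hvec last_ix w = axis last_ix 1"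
  by (simp add: hvec_def)

lemma LL_last_power:
  assumes "holo_on f siegel" "z \<in> siegel"
  shows "(LL last_ix ^^ k) f z = (pd (axis last_ix 1) ^^ k) f z"
  using foldr_LL(2)[OF assms(1) open_siegel assms(2), of "replicate k last_ix"] by simp

lemma holo_on_pd_power: "holo_on f siegel \<Longrightarrow> holo_on ((pd v ^^ k) f) siegel"
  by (induction k) (auto intro: holo_on_pd open_siegel)

text \<open>The a priori bound \<open>B\<close> supplies only the decay along vertical rays and is
  absent from the conclusion, so the constant is uniform in \<open>f\<close>.\<close>

lemma inv_grad_le_of_LL_last_power:
  fixes f :: "('n::{finite,linorder}) cvec \<Rightarrow> complex" and B M :: real
  assumes f: "holo_on f siegel" and B: "\<And>z. z \<in> siegel \<Longrightarrow> inv_grad f z \<le> B" and N: "N > 0"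
    and M: "\<And>z. z \<in> siegel \<Longrightarrow> cmod ((LL last_ix ^^ N) f z) \<le> M / rho z ^ N"
    and w: "w \<in> siegel"
  shows "inv_grad f w \<le> sqrt (2 * CARD('n) * (16 * CARD('n))\<^sup>2 + 8) * M"
proof -
  let ?e = "axis last_ix 1 :: 'n cvec"
  let ?n = "real CARD('n)"
  have rpos: "rho z > 0" if "z \<in> siegel" for z :: "'n cvec"
    using that by (simp add: siegel_def)
  have M0: "0 \<le> M"
    using order_trans[OF norm_ge_zero M[OF w]] zero_less_power[OF rpos[OF w], of N]
    by (auto simp: zero_le_divide_iff)
  have up: "z + (\<i> * of_real t) *s ?e \<in> siegel" "rho (z + (\<i> * of_real t) *s ?e) = rho z + t"
    if "z \<in> siegel" "0 \<le> t" for z and t :: real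
    using that by (simp_all add: siegel_def rho_vertical)
  \<comment> \<open>Descent from \<open>N\<close> by one integration per order; the gain
    \<open>1 / k\<close> is discarded. It stops at 1 because the decay comes from
    \<open>norm_foldr_LL_le\<close>, which speaks only of nonempty words.\<close>
  have pow: "\<forall>z\<in>siegel. cmod ((pd ?e ^^ k) f z) \<le> M / rho z powr k" if "1 \<le> k" "k \<le> N" for k
    using that(2,1)
  proof (induction rule: inc_induct)
    case base
    then show ?case
      using M rpos by (auto simp: LL_last_power[OF f] powr_realpow)
  next
    case (step k)
    show ?case
    proof
      fix z :: "'n cvec" assume z: "z \<in> siegel"
      have "cmod ((pd ?e ^^ k) f z) \<le> M / k / rho z powr k"
      proof (rule norm_le_vertical_derivative[OF holo_on_pd_power[OF f] z])
        fix t :: real assume t: "0 \<le> t"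
        let ?z = "z + (\<i> * of_real t) *s ?e"
        show "cmod (pd ?e ((pd ?e ^^ k) f) ?z) \<le> M / (rho z + t) powr (real k + 1)"
          using bspec[OF step.IH up(1)[OF z t]] unfolding up(2)[OF z t] by (simp add: add.commute)
        show "cmod ((pd ?e ^^ k) f ?z) \<le> 6 * (2 * CARD('n) * k) ^ (k - 1) * B / (rho z + t) powr k"
          using norm_foldr_LL_le[OF f B up(1)[OF z t], of "replicate k last_ix"] up[OF z t] step.prems
          by (simp add: LL_last_power[OF f] sum_list_replicate wt_def)
      qed (use step.prems in auto)
      also have "\<dots> \<le> M / rho z powr k"
      proof -
        have "M / k \<le> M / 1"
          using M0 step.prems by (intro divide_left_mono) auto
        then show ?thesis by (intro divide_right_mono) auto
      qed
      finally show "cmod ((pd ?e ^^ k) f z) \<le> M / rho z powr k" .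
    qed
  qed
  have first: "cmod (pd ?e f z) \<le> M / rho z" if "z \<in> siegel" for z
    using bspec[OF pow[of 1] that] N rpos[OF that] by simp
  \<comment> \<open>One Cauchy estimate on the full polydisc: \<open>rho y \<ge> rho z / 4\<close>
    costs a factor 4 and the radius a factor \<open>2 * ?n\<close>; the exponent is
    \<open>1 + 1/2\<close>.\<close>
  have mixed: "cmod (pd (hvec j z) (pd ?e f) z) \<le> 8 * ?n * M / rho z powr (3/2)"
    if z: "z \<in> siegel" and j: "j \<noteq> last_ix" for z j
  proof -
    have n: "?n > 0" by simp
    have "cmod (foldr (\<lambda>j. pd (hvec j z)) [j] (pd ?e f) z)
        \<le> 4 * M / rho z / ((1 / (2 * ?n)) ^ length [j] * rho z powr (sum_list (map wt [j])))"
    proof (rule foldr_pd_bound[where t = 0])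
      fix y assume "y \<in> hpolydisc z (0 + length [j] * (1 / (2 * ?n)))"
      then have y: "y \<in> hpolydisc z (1 / (2 * CARD('n)))" by simp
      have le: "rho z / 4 \<le> rho y"
        by (rule rho_hpolydisc[OF z _ order_refl y]) simp
      then have "y \<in> siegel" using rpos[OF z] by (simp add: siegel_def)
      then have "cmod (pd ?e f y) \<le> M / rho y" by (rule first)
      also have "\<dots> \<le> M / (rho z / 4)"
        using le rpos[OF z] M0 by (intro divide_left_mono) auto
      finally show "cmod (pd ?e f y) \<le> 4 * M / rho z" by (simp add: mult.commute)
    qed (use z in \<open>auto intro: holo_on_pd[OF f open_siegel] center_in_hpolydisc\<close>)
    also have "\<dots> = 8 * ?n * M / (rho z powr 1 * rho z powr (1/2))"
      using j rpos[OF z] by (simp add: wt_def)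
    also have "\<dots> = 8 * ?n * M / rho z powr (3/2)"
      by (simp only: powr_add[symmetric]) simp
    finally show ?thesis by simp
  qed
  have tang: "cmod (LL j f w) \<le> 16 * ?n * M / rho w powr (1/2)" if j: "j \<noteq> last_ix" for j
  proof -
    \<comment> \<open>Vertical translation leaves the coordinate \<open>j\<close> of
      \<open>w\<close> alone, so one frozen direction serves the whole ray.\<close>
    have hv: "hvec j (w + c *s ?e) = hvec j w" for c
      using j by (simp add: hvec_def axis_def)
    \<comment> \<open>Integration with \<open>a = 1/2\<close> doubles the constant of
      \<open>mixed\<close>, which bounds the vertical derivative after commuting the two
      derivatives.\<close>
    have "cmod (pd (hvec j w) f w) \<le> 8 * ?n * M / (1/2) / rho w powr (1/2)"
    proof (rule norm_le_vertical_derivative[OF holo_on_pd[OF f open_siegel] w])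
      fix t :: real assume t: "0 \<le> t"
      let ?z = "w + (\<i> * of_real t) *s ?e"
      show "cmod (pd ?e (pd (hvec j w) f) ?z) \<le> 8 * ?n * M / (rho w + t) powr (1/2 + 1)"
        using mixed[OF up(1)[OF w t] j] pd_commute[OF f open_siegel up(1)[OF w t], of ?e "hvec j w"]
        by (simp add: up[OF w t] hv)
      show "cmod (pd (hvec j w) f ?z) \<le> 6 * B / (rho w + t) powr (1/2)"
        using norm_foldr_LL_le[OF f B up(1)[OF w t], of "[j]"] foldr_LL(2)[OF f open_siegel up(1)[OF w t], of "[j]"] j
        by (simp add: up[OF w t] hv wt_def)
    qed auto
    then show ?thesis
      using foldr_LL(2)[OF f open_siegel w, of "[j]"] by simp
  qed
  have "rho w * (\<Sum>j\<in>UNIV - {last_ix}. (cmod (LL j f w))\<^sup>2)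
      \<le> rho w * (\<Sum>j\<in>(UNIV - {last_ix} :: 'n set). (16 * ?n * M)\<^sup>2 / rho w)"
  proof (intro mult_left_mono sum_mono)
    fix j :: 'n assume "j \<in> UNIV - {last_ix}"
    then have "(cmod (LL j f w))\<^sup>2 \<le> (16 * ?n * M / rho w powr (1/2))\<^sup>2"
      using tang[of j] by (intro power_mono) auto
    then show "(cmod (LL j f w))\<^sup>2 \<le> (16 * ?n * M)\<^sup>2 / rho w"
      using rpos[OF w] by (simp add: power_divide powr_half_sqrt)
  qed (use rpos[OF w] in auto)
  also have "\<dots> = real (card (UNIV - {last_ix} :: 'n set)) * (16 * ?n * M)\<^sup>2"
    using rpos[OF w] by simp
  also have "\<dots> \<le> ?n * (16 * ?n * M)\<^sup>2"
    by (intro mult_right_mono) (auto simp: card_mono)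
  finally have 1: "rho w * (\<Sum>j\<in>UNIV - {last_ix}. (cmod (LL j f w))\<^sup>2) \<le> ?n * (16 * ?n * M)\<^sup>2" .
  have "cmod (LL last_ix f w) \<le> M / rho w"
    using first[OF w] LL_last_power[OF f w, of 1] by simp
  then have "rho w * cmod (LL last_ix f w) \<le> M"
    using rpos[OF w] by (simp add: field_simps)
  then have 2: "(rho w)\<^sup>2 * (cmod (LL last_ix f w))\<^sup>2 \<le> M\<^sup>2"
    using power_mono[of "rho w * cmod (LL last_ix f w)" M 2] rpos[OF w] by (simp add: power_mult_distrib)
  have "inv_grad f w \<le> sqrt ((2 * CARD('n) * (16 * CARD('n))\<^sup>2 + 8) * M\<^sup>2)"
    unfolding inv_grad_def
    using 1 2 by (intro real_sqrt_le_mono) (simp add: power_mult_distrib algebra_simps)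
  then show ?thesis
    using M0 by (simp add: real_sqrt_mult)
qed

section \<open>Comparison of the norms\<close>

lemma foldr_funpow: "foldr (\<lambda>j g. (F j ^^ \<alpha> j) g) xs f = foldr F (concat (map (\<lambda>j. replicate (\<alpha> j) j) xs)) f"
  by (induction xs) auto

text \<open>Repeating each index \<open>\<alpha> j\<close> times spells out the multi-index as a
  word independent of \<open>f\<close>, to which the estimates for lists of operators apply.\<close>

lemma LL_multi_conv_foldr:
  fixes \<alpha> :: "'n::{finite,linorder} \<Rightarrow> nat"
  obtains js where "length js = mi_abs \<alpha>" "sum_list (map wt js) = mi_weight \<alpha>"
    "\<And>f. LL_multi \<alpha> f = foldr LL js f"
proof
  let ?xs = "sorted_list_of_set (UNIV :: 'n set)"
  let ?js = "concat (map (\<lambda>j. replicate (\<alpha> j) j) ?xs)"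
  have sum: "sum_list (map g ?xs) = sum g UNIV" for g :: "'n \<Rightarrow> 'b::comm_monoid_add"
    by (simp add: sum_list_distinct_conv_sum_set)
  show "length ?js = mi_abs \<alpha>"
    by (simp add: length_concat o_def sum mi_abs_def)
  have "sum_list (map wt (concat (map (\<lambda>j. replicate (\<alpha> j) j) xs))) = sum_list (map (\<lambda>j. \<alpha> j * wt j) xs)" for xs :: "'n list"
    by (induction xs) (auto simp: sum_list_replicate)
  then have "sum_list (map wt ?js) = (\<Sum>j\<in>UNIV. \<alpha> j * wt j)"
    by (simp add: sum)
  also have "\<dots> = \<alpha> last_ix * wt (last_ix :: 'n) + (\<Sum>j\<in>UNIV - {last_ix}. \<alpha> j * wt j)"
    by (rule sum.remove) auto
  also have "(\<Sum>j\<in>UNIV - {last_ix}. \<alpha> j * wt j) = (\<Sum>j\<in>UNIV - {last_ix}. real (\<alpha> j) / 2)"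
    by (rule sum.cong) (auto simp: wt_def)
  finally show "sum_list (map wt ?js) = mi_weight \<alpha>"
    by (simp add: mi_weight_def wt_def[of last_ix] sum_divide_distrib)
  show "LL_multi \<alpha> f = foldr LL ?js f" for f
    by (simp add: LL_multi_def foldr_funpow)
qed

section \<open>The inequalities between the three norms\<close>

lemma bloch_spaceD:
  assumes "f \<in> bloch_space"
  obtains B where "0 \<le> B" "bloch_norm f = ennreal B" "holo_on f siegel"
    "\<And>z. z \<in> siegel \<Longrightarrow> inv_grad f z \<le> B"
proof
  have fin: "bloch_norm f < \<infinity>" and "holo_on f siegel"
    using assms by (auto simp: bloch_space_def)
  then show "holo_on f siegel" by simp
  show eq: "bloch_norm f = ennreal (enn2real (bloch_norm f))"
    using fin by simp
  show "0 \<le> enn2real (bloch_norm f)" by simp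
  show "inv_grad f z \<le> enn2real (bloch_norm f)" if "z \<in> siegel" for z
  proof -
    have "ennreal (inv_grad f z) \<le> bloch_norm f"
      unfolding bloch_norm_def using that by (rule SUP_upper)
    then show ?thesis
      using eq by (metis enn2real_nonneg ennreal_le_iff)
  qed
qed

lemma norm_all_le_bloch_norm:
  assumes "N > 0"
  obtains C where "C > 0"
    "\<And>f :: ('n::{finite,linorder}) cvec \<Rightarrow> complex. f \<in> bloch_space \<Longrightarrow> norm_all N f \<le> ennreal C * bloch_norm f"
proof
  let ?A = "{\<alpha> :: 'n \<Rightarrow> nat. mi_abs \<alpha> = N}"
  define K where "K = 6 * (2 * real CARD('n) * N) ^ (N - 1)"
  have K: "K > 0" using assms by (simp add: K_def)
  \<comment> \<open>The summand 1 makes the constant positive without an argument that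
    \<open>?A\<close> is nonempty.\<close>
  show "real (card ?A) * K + 1 > 0" using K by (simp add: add_nonneg_pos)
  fix f :: "'n cvec \<Rightarrow> complex" assume "f \<in> bloch_space"
  then obtain B where B: "0 \<le> B" "bloch_norm f = ennreal B" "holo_on f siegel"
    "\<And>z. z \<in> siegel \<Longrightarrow> inv_grad f z \<le> B"
    using bloch_spaceD by metis
  have "norm_all N f \<le> (\<Sum>\<alpha>\<in>?A. ennreal (K * B))"
    unfolding norm_all_def
  proof (rule sum_mono)
    fix \<alpha> :: "'n \<Rightarrow> nat" assume "\<alpha> \<in> ?A"
    then obtain js where js: "length js = N" "sum_list (map wt js) = mi_weight \<alpha>"
      "LL_multi \<alpha> f = foldr LL js f"
      using LL_multi_conv_foldr[of \<alpha>] by (metis mem_Collect_eq)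
    show "sup_norm (\<lambda>z. of_real (rho z powr mi_weight \<alpha>) * LL_multi \<alpha> f z) \<le> ennreal (K * B)"
      unfolding sup_norm_def
    proof (rule SUP_least)
      fix z :: "'n cvec" assume z: "z \<in> siegel"
      then have rz: "rho z > 0" by (simp add: siegel_def)
      have "cmod (foldr LL js f z) \<le> K * B / rho z powr mi_weight \<alpha>"
        using norm_foldr_LL_le[OF B(3,4) z, of js] js assms by (auto simp: K_def)
      then show "ennreal (cmod (of_real (rho z powr mi_weight \<alpha>) * LL_multi \<alpha> f z)) \<le> ennreal (K * B)"
        using rz by (intro ennreal_leI) (simp add: norm_mult js(3) field_simps)
    qed
  qed
  also have "\<dots> = ennreal (card ?A * (K * B))"
    using K B(1) by (simp add: ennreal_mult ennreal_of_nat_eq_real_of_nat)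
  also have "\<dots> \<le> ennreal ((card ?A * K + 1) * B)"
    using B(1) by (intro ennreal_leI) (simp add: algebra_simps)
  also have "\<dots> = ennreal (card ?A * K + 1) * bloch_norm f"
    using K B by (simp add: ennreal_mult)
  finally show "norm_all N f \<le> ennreal (card ?A * K + 1) * bloch_norm f" .
qed

lemma norm_last_le_norm_all:
  fixes f :: "('n::{finite,linorder}) cvec \<Rightarrow> complex"
  shows "norm_last N f \<le> norm_all N f"
proof -
  \<comment> \<open>\<open>norm_last\<close> is the summand of \<open>norm_all\<close> at this
    multi-index; on \<open>siegel\<close> the real power with exponent \<open>N\<close> is the
    ordinary one.\<close>
  let ?\<alpha> = "\<lambda>j::'n. if j = last_ix then N else 0"
  have "foldr (\<lambda>j g. (LL j ^^ ?\<alpha> j) g) xs f = (if last_ix \<in> set xs then (LL last_ix ^^ N) f else f)"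
    if "distinct xs" for xs
    using that by (induction xs) auto
  then have L: "LL_multi ?\<alpha> f = (LL last_ix ^^ N) f"
    by (simp add: LL_multi_def)
  have W: "mi_weight ?\<alpha> = N"
    by (simp add: mi_weight_def)
  have "norm_last N f = sup_norm (\<lambda>z. of_real (rho z powr mi_weight ?\<alpha>) * LL_multi ?\<alpha> f z)"
    unfolding norm_last_def sup_norm_def L W
    by (intro SUP_cong) (auto simp: siegel_def powr_realpow)
  also have "\<dots> \<le> norm_all N f"
    unfolding norm_all_def
    by (rule member_le_sum[OF _ _ finite_mi_abs]) (auto simp: mi_abs_def)
  finally show ?thesis .
qed

lemma bloch_norm_le_norm_last:
  fixes f :: "('n::{finite,linorder}) cvec \<Rightarrow> complex"
  assumes "N > 0" "f \<in> bloch_space"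
  shows "bloch_norm f \<le> ennreal (sqrt (2 * CARD('n) * (16 * CARD('n))\<^sup>2 + 8)) * norm_last N f"
proof -
  let ?C = "sqrt (2 * CARD('n) * (16 * CARD('n))\<^sup>2 + 8)"
  obtain B where B: "0 \<le> B" "bloch_norm f = ennreal B" "holo_on f siegel"
    "\<And>z. z \<in> siegel \<Longrightarrow> inv_grad f z \<le> B"
    using bloch_spaceD[OF assms(2)] by metis
  \<comment> \<open>The upper estimate is used first to see that \<open>norm_last N f\<close> is
    finite, so that it can serve as the real constant \<open>M\<close> below.\<close>
  obtain C where "norm_all N f \<le> ennreal C * bloch_norm f"
    using norm_all_le_bloch_norm[OF assms(1)] assms(2) by metis
  then have "norm_last N f \<le> ennreal C * bloch_norm f"
    using norm_last_le_norm_all order_trans by blast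
  also have "\<dots> < \<infinity>" by (simp add: B(2) ennreal_mult_less_top)
  finally obtain M where M: "0 \<le> M" "norm_last N f = ennreal M"
    by (cases "norm_last N f") auto
  have "cmod ((LL last_ix ^^ N) f z) \<le> M / rho z ^ N" if z: "z \<in> siegel" for z
  proof -
    have rz: "rho z > 0" using z by (simp add: siegel_def)
    have "ennreal (cmod (of_real (rho z ^ N) * (LL last_ix ^^ N) f z)) \<le> ennreal M"
      unfolding M(2)[symmetric] norm_last_def sup_norm_def by (rule SUP_upper[OF z])
    then show ?thesis
      using M(1) rz by (simp add: norm_mult norm_power field_simps)
  qed
  from inv_grad_le_of_LL_last_power[OF B(3,4) assms(1) this]
  have "inv_grad f z \<le> ?C * M" if "z \<in> siegel" for z
    using that by simp
  then have "bloch_norm f \<le> ennreal (?C * M)"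
    unfolding bloch_norm_def by (intro SUP_least ennreal_leI)
  then show ?thesis using M by (simp add: ennreal_mult)
qed

lemma comparable_onI:
  assumes "0 < C" "0 < D" "\<And>f. f \<in> S \<Longrightarrow> A f \<le> ennreal C * B f" "\<And>f. f \<in> S \<Longrightarrow> B f \<le> ennreal D * A f"
  shows "comparable_on S A B"
  unfolding comparable_on_def
proof (intro exI conjI ballI)
  show "ennreal (1 / C) * A f \<le> B f" if "f \<in> S" for f
  proof -
    have "ennreal (1 / C) * A f \<le> ennreal (1 / C) * (ennreal C * B f)"
      using assms(3)[OF that] by (rule mult_left_mono) simp
    also have "\<dots> = B f"
      using assms(1) by (simp add: mult.assoc[symmetric] ennreal_mult[symmetric])
    finally show ?thesis .
  qed
  show "B f \<le> ennreal D * A f" if "f \<in> S" for f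
    using assms(4)[OF that] .
qed (use assms in auto)

theorem theorem1p2:
  fixes N :: nat
  assumes "N > 0"
  shows "comparable_on (bloch_space :: (('n::{finite,linorder}) cvec \<Rightarrow> complex) set)
           bloch_norm (norm_last N)
       \<and> comparable_on (bloch_space :: ('n cvec \<Rightarrow> complex) set)
           (norm_last N) (norm_all N)
       \<and> comparable_on (bloch_space :: ('n cvec \<Rightarrow> complex) set)
           bloch_norm (norm_all N)"
proof -
  define D where "D = sqrt (2 * CARD('n) * (16 * CARD('n))\<^sup>2 + 8)"
  have D: "D > 0" by (simp add: D_def add_nonneg_pos)
  obtain C where C: "C > 0" and
    all: "\<And>f :: 'n cvec \<Rightarrow> complex. f \<in> bloch_space \<Longrightarrow> norm_all N f \<le> ennreal C * bloch_norm f"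
    using norm_all_le_bloch_norm[OF assms] by metis
  have bloch: "bloch_norm f \<le> ennreal D * norm_last N f"
    if "f \<in> bloch_space" for f :: "'n cvec \<Rightarrow> complex"
    unfolding D_def by (rule bloch_norm_le_norm_last[OF assms that])
  have last: "norm_last N f \<le> norm_all N f" for f :: "'n cvec \<Rightarrow> complex"
    by (rule norm_last_le_norm_all)
  \<comment> \<open>The bounds \<open>bloch\<close>, \<open>last\<close> and \<open>all\<close> form
    a cycle through the three norms; the missing directions are their compositions.\<close>
  have "norm_all N f \<le> ennreal (C * D) * norm_last N f"
    if "f \<in> bloch_space" for f :: "'n cvec \<Rightarrow> complex"
    using order_trans[OF all[OF that] mult_left_mono[OF bloch[OF that]]] C D
    by (simp add: ennreal_mult mult.assoc)
  moreover have "bloch_norm f \<le> ennreal D * norm_all N f"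
    if "f \<in> bloch_space" for f :: "'n cvec \<Rightarrow> complex"
    using order_trans[OF bloch[OF that] mult_left_mono[OF last]] by simp
  moreover have "norm_last N f \<le> ennreal C * bloch_norm f"
    if "f \<in> bloch_space" for f :: "'n cvec \<Rightarrow> complex"
    using order_trans[OF last all[OF that]] .
  ultimately show ?thesis
    using C D all bloch last
    by (intro conjI comparable_onI[of D C] comparable_onI[of 1 "C * D"]) auto
qed

end
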